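(* Let $\Theta\in\mathbf S(\mathfrak M,\mathfrak N)$ and let $\{\Gamma_k\}_{k\ge0}$ be its Schur parameters. Suppose that, for some $n\ge0$, $\mathfrak D_{\Gamma_{2n+1}}\ne\{0\}$ and $\mathfrak D_{\Gamma^*_{2n+1}}\ne\{0\}$. Then for each $z\in\mathbb D$ $$P_{\mathcal K_n}\left(I_{\mathfrak H_0}-z\mathcal T_0\right)^{-1}\upharpoonright\mathcal K_n=\left(I_{\mathcal K_n}-z\mathcal S_{n,\Theta_{2n+2}(z)}\right)^{-1},$$ $$P_{\widetilde{\mathcal K}_n}\left(I_{\widetilde{\mathfrak H}_0}-z\widetilde{\mathcal T}_0\right)^{-1}\upharpoonright\widetilde{\mathcal K}_n=\left(I_{\widetilde{\mathcal K}_n}-z\widetilde{\mathcal S}_{n,\Theta_{2n+2}(z)}\right)^{-1},$$ where $\mathcal T_0,\widetilde{\mathcal T}_0$ are the truncated block operator CMV matrices of $\{\Gamma_k\}$ and $\Theta_{2n+2}$ is the $(2n+2)$-th function associated with $\Theta$ by the Schur algorithm.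
   Context: All Hilbert spaces are complex (infinite-dimensional ones are separable). $\mathbf L(H_1,H_2)$ denotes the bounded operators; $P_L$ is the orthogonal projection onto a subspace $L$ (regarded as a map into $L$), $X\upharpoonright L$ is restriction. For a contraction $T$: $D_T=(I-T^*T)^{1/2}$, $\mathfrak D_T=\overline{\operatorname{ran}}\,D_T$. $\mathbf S(\mathfrak M,\mathfrak N)$ is the Schur class: holomorphic $\Theta:\mathbb D\to\mathbf L(\mathfrak M,\mathfrak N)$ with $\|\Theta(z)\|\le1$. Schur algorithm: $\Theta_0=\Theta$, $\Gamma_k=\Theta_k(0)$, and $\Theta_{k+1}\in\mathbf S(\mathfrak D_{\Gamma_k},\mathfrak D_{\Gamma_k^*})$ is the unique function with $\Theta_k(z)=\Gamma_k+zD_{\Gamma_k^*}\Theta_{k+1}(z)(I+z\Gamma_k^*\Theta_{k+1}(z))^{-1}D_{\Gamma_k}$, $z\in\mathbb D$. The $\Gamma_k$ are the Schur parameters and $\Theta_k$ is the $k$-th associated function; $\Gamma_0\in\mathbf L(\mathfrak M,\mathfrak N)$, $\Gamma_k\in\mathbf L(\mathfrak D_{\Gamma_{k-1}},\mathfrak D_{\Gamma_{k-1}^*})$. Some of the spaces $\mathfrak D_{\Gamma_k},\mathfrak D_{\Gamma_k^*}$ with $k\ge 2n+2$ may be $\{0\}$ (if some $\Gamma_m$ is isometric, co-isometric or unitary); then later parameters are zero operators from or to $\{0\}$, and all definitions below are read with these zero summands (if $\Gamma_m$ is unitary all later summands are $\{0\}$). Elementary rotations, unitary for every $k$ (with $\mathfrak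 D_{\Gamma_{-1}}:=\mathfrak M$, $\mathfrak D_{\Gamma_{-1}^*}:=\mathfrak N$): $$\mathbf J_{\Gamma_k}=\begin{bmatrix}\Gamma_k&D_{\Gamma_k^*}\\ D_{\Gamma_k}&-\Gamma_k^*\end{bmatrix}:\mathfrak D_{\Gamma_{k-1}}\oplus\mathfrak D_{\Gamma_k^*}\to\mathfrak D_{\Gamma_{k-1}^*}\oplus\mathfrak D_{\Gamma_k}.$$ Put $\mathcal H_k=\mathfrak D_{\Gamma_{2k-2}}\oplus\mathfrak D_{\Gamma^*_{2k-1}}$, $\widetilde{\mathcal H}_k=\mathfrak D_{\Gamma^*_{2k-2}}\oplus\mathfrak D_{\Gamma_{2k-1}}$ ($k\ge1$), $\mathfrak H_0=\bigoplus_{k\ge1}\mathcal H_k$, $\widetilde{\mathfrak H}_0=\bigoplus_{k\ge1}\widetilde{\mathcal H}_k$, $\mathcal K_n=\bigoplus_{k=1}^{n+1}\mathcal H_k\subset\mathfrak H_0$, $\widetilde{\mathcal K}_n=\bigoplus_{k=1}^{n+1}\widetilde{\mathcal H}_k\subset\widetilde{\mathfrak H}_0$. Truncated block operator CMV matrices: let $\mathcal V_0=\bigoplus_{k\ge1}\mathbf J_{\Gamma_{2k-1}}:\mathfrak H_0\to\widetilde{\mathfrak H}_0$ and $\mathcal W_0=-\Gamma_0^*\oplus\bigoplus_{k\ge1}\mathbf J_{\Gamma_{2k}}$, mapping $\widetilde{\mathfrak H}_0=\mathfrak D_{\Gamma_0^*}\oplus\bigoplus_{k\ge1}(\mathfrak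 D_{\Gamma_{2k-1}}\oplus\mathfrak D_{\Gamma_{2k}^*})$ to $\mathfrak H_0=\mathfrak D_{\Gamma_0}\oplus\bigoplus_{k\ge1}(\mathfrak D_{\Gamma_{2k-1}^*}\oplus\mathfrak D_{\Gamma_{2k}})$. Then $\mathcal T_0=\mathcal W_0\mathcal V_0$ on $\mathfrak H_0$ and $\widetilde{\mathcal T}_0=\mathcal V_0\mathcal W_0$ on $\widetilde{\mathfrak H}_0$. For a contraction $\Gamma\in\mathbf L(\mathfrak D_{\Gamma_{2n+1}},\mathfrak D_{\Gamma_{2n+1}^*})$ put $\mathcal V_n=\bigoplus_{k=1}^{n+1}\mathbf J_{\Gamma_{2k-1}}:\mathcal K_n\to\widetilde{\mathcal K}_n$ and $\mathcal W_{n,\Gamma}=-\Gamma_0^*\oplus\bigoplus_{k=1}^n\mathbf J_{\Gamma_{2k}}\oplus\Gamma$, mapping $\widetilde{\mathcal K}_n=\mathfrak D_{\Gamma_0^*}\oplus\bigoplus_{k=1}^n(\mathfrak D_{\Gamma_{2k-1}}\oplus\mathfrak D_{\Gamma_{2k}^*})\oplus\mathfrak D_{\Gamma_{2n+1}}$ to $\mathcal K_n=\mathfrak D_{\Gamma_0}\oplus\bigoplus_{k=1}^n(\mathfrak D_{\Gamma_{2k-1}^*}\oplus\mathfrak D_{\Gamma_{2k}})\oplus\mathfrak D_{\Gamma_{2n+1}^*}$. Then $\mathcal S_{n,\Gamma}=\mathcal W_{n,\Gamma}\mathcal V_n$ on $\mathcal K_n$ and $\widetilde{\mathcal S}_{n,\Gamma}=\mathcal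 V_n\mathcal W_{n,\Gamma}$ on $\widetilde{\mathcal K}_n$. In the claim these are used, for each fixed $z$, with $\Gamma=\Theta_{2n+2}(z)$. *)

theory Defs
  imports "HOL-Analysis.Analysis"
begin

section \<open>Complex Hilbert spaces\<close>

text \<open>
  A complex inner product space is given together with its underlying real inner product space,
  whose inner product is the real part of the complex one. The norm is thus
  \<open>sqrt (Re (cinner x x))\<close>, and the library instances for norms, topology and binary products apply.
  The complex inner product is linear in the first argument.
\<close>

class complex_inner = real_inner +
  fixes scaleC :: "complex \<Rightarrow> 'a \<Rightarrow> 'a" (infixr \<open>*\<^sub>C\<close> 75)
    and cinner :: "'a \<Rightarrow> 'a \<Rightarrow> complex"
  assumes scaleC_add_right: "a *\<^sub>C (x + y) = a *\<^sub>C x + a *\<^sub>C y"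
    and scaleC_add_left: "(a + b) *\<^sub>C x = a *\<^sub>C x + b *\<^sub>C x"
    and scaleC_scaleC: "a *\<^sub>C b *\<^sub>C x = (a * b) *\<^sub>C x"
    and scaleR_scaleC: "r *\<^sub>R x = complex_of_real r *\<^sub>C x"
    and cinner_commute: "cinner x y = cnj (cinner y x)"
    and cinner_add_left: "cinner (x + y) w = cinner x w + cinner y w"
    and cinner_scaleC_left: "cinner (a *\<^sub>C x) y = a * cinner x y"
    and Re_cinner: "Re (cinner x y) = inner x y"

class chilbert_space = complex_inner + complete_space

instantiation prod :: (complex_inner, complex_inner) complex_inner
begin

definition scaleC_prod :: "complex \<Rightarrow> 'a \<times> 'b \<Rightarrow> 'a \<times> 'b"
  where "scaleC_prod a x = (a *\<^sub>C fst x, a *\<^sub>C snd x)"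

definition cinner_prod :: "'a \<times> 'b \<Rightarrow> 'a \<times> 'b \<Rightarrow> complex"
  where "cinner_prod x y = cinner (fst x) (fst y) + cinner (snd x) (snd y)"

instance
proof
  fix a b :: complex and r :: real and x y w :: "'a \<times> 'b"
  show "a *\<^sub>C (x + y) = a *\<^sub>C x + a *\<^sub>C y"
    by (simp add: scaleC_prod_def scaleC_add_right)
  show "(a + b) *\<^sub>C x = a *\<^sub>C x + b *\<^sub>C x"
    by (simp add: scaleC_prod_def scaleC_add_left)
  show "a *\<^sub>C b *\<^sub>C x = (a * b) *\<^sub>C x"
    by (simp add: scaleC_prod_def scaleC_scaleC)
  show "r *\<^sub>R x = complex_of_real r *\<^sub>C x"
    by (simp add: scaleC_prod_def scaleR_prod_def scaleR_scaleC)
  show "cinner x y = cnj (cinner y x)"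
    using cinner_commute[of "fst x" "fst y"] cinner_commute[of "snd x" "snd y"]
    by (simp add: cinner_prod_def)
  show "cinner (x + y) w = cinner x w + cinner y w"
    by (simp add: cinner_prod_def cinner_add_left)
  show "cinner (a *\<^sub>C x) y = a * cinner x y"
    by (simp add: cinner_prod_def scaleC_prod_def cinner_scaleC_left algebra_simps)
  show "Re (cinner x y) = inner x y"
    by (simp add: cinner_prod_def inner_prod_def Re_cinner)
qed

end

instance prod :: (chilbert_space, chilbert_space) chilbert_space ..

lemma norm_scaleC: "norm (a *\<^sub>C x) = cmod a * norm (x :: 'a :: complex_inner)"
proof -
  have "cinner (a *\<^sub>C x) (a *\<^sub>C x) = a * cnj a * cinner x x"
    using cinner_commute[of x "a *\<^sub>C x"] cinner_commute[of x x, symmetric]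
    by (simp add: cinner_scaleC_left)
  also have "a * cnj a = complex_of_real ((cmod a)\<^sup>2)"
    by (simp only: complex_norm_square)
  finally have "Re (cinner (a *\<^sub>C x) (a *\<^sub>C x)) = Re (complex_of_real ((cmod a)\<^sup>2) * cinner x x)"
    by simp
  then have "inner (a *\<^sub>C x) (a *\<^sub>C x) = (cmod a)\<^sup>2 * inner x x"
    unfolding Re_cinner[symmetric] by (simp del: of_real_power)
  then show ?thesis
    by (simp add: norm_eq_sqrt_inner real_sqrt_mult)
qed


section \<open>Countable orthogonal sums\<close>

text \<open>
  The Hilbert space of square summable sequences in a Hilbert space. An orthogonal sum of a sequence
  of closed subspaces of that space is the subspace of the sequences whose entries lie in them.
\<close>

typedef (overloaded) 'a hsum = "{f :: nat \<Rightarrow> 'a :: real_normed_vector. summable (\<lambda>j. (norm (f j))\<^sup>2)}"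
  morphisms hnth Abs_hsum
  by (rule exI[of _ "\<lambda>_. 0"]) simp

lemma summable_hnth: "summable (\<lambda>j. (norm (hnth f j))\<^sup>2)"
  using hnth[of f] by simp

lemma hsum_eqI: "(\<And>j. hnth f j = hnth g j) \<Longrightarrow> f = g"
  by (metis ext hnth_inject)

lemma hnth_Abs: "summable (\<lambda>j. (norm (f j))\<^sup>2) \<Longrightarrow> hnth (Abs_hsum f) = f"
  by (simp add: Abs_hsum_inverse)

lemma norm_add_sq_le: "(norm (x + y))\<^sup>2 \<le> 2 * (norm x)\<^sup>2 + 2 * (norm (y :: 'a :: real_normed_vector))\<^sup>2"
proof -
  have "(norm (x + y))\<^sup>2 \<le> (norm x + norm y)\<^sup>2"
    by (intro power_mono norm_triangle_ineq) auto
  also have "\<dots> \<le> 2 * (norm x)\<^sup>2 + 2 * (norm y)\<^sup>2"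
    using sum_squares_bound[of "norm x" "norm y"] by (simp add: power2_sum)
  finally show ?thesis .
qed

lemma summable_sq_add:
  fixes f g :: "nat \<Rightarrow> 'a :: real_normed_vector"
  assumes "summable (\<lambda>j. (norm (f j))\<^sup>2)" "summable (\<lambda>j. (norm (g j))\<^sup>2)"
  shows "summable (\<lambda>j. (norm (f j + g j))\<^sup>2)"
  by (rule summable_comparison_test'[of "\<lambda>j. 2 * (norm (f j))\<^sup>2 + 2 * (norm (g j))\<^sup>2" 0])
     (auto intro!: summable_add summable_mult assms norm_add_sq_le)

instantiation hsum :: (real_normed_vector) real_vector
begin

definition zero_hsum :: "'a hsum" where "0 = Abs_hsum (\<lambda>_. 0)"
definition plus_hsum :: "'a hsum \<Rightarrow> 'a hsum \<Rightarrow> 'a hsum"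
  where "f + g = Abs_hsum (\<lambda>j. hnth f j + hnth g j)"
definition uminus_hsum :: "'a hsum \<Rightarrow> 'a hsum" where "- f = Abs_hsum (\<lambda>j. - hnth f j)"
definition minus_hsum :: "'a hsum \<Rightarrow> 'a hsum \<Rightarrow> 'a hsum" where "f - g = f + - (g :: 'a hsum)"
definition scaleR_hsum :: "real \<Rightarrow> 'a hsum \<Rightarrow> 'a hsum" where "r *\<^sub>R f = Abs_hsum (\<lambda>j. r *\<^sub>R hnth f j)"

lemma hnth_zero [simp]: "hnth (0 :: 'a hsum) j = 0"
  by (simp add: zero_hsum_def hnth_Abs)

lemma hnth_add [simp]: "hnth (f + g :: 'a hsum) j = hnth f j + hnth g j"
  by (simp add: plus_hsum_def hnth_Abs summable_sq_add summable_hnth)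

lemma hnth_uminus [simp]: "hnth (- f :: 'a hsum) j = - hnth f j"
  by (simp add: uminus_hsum_def hnth_Abs summable_hnth)

lemma hnth_diff [simp]: "hnth (f - g :: 'a hsum) j = hnth f j - hnth g j"
  by (simp add: minus_hsum_def)

lemma hnth_scaleR [simp]: "hnth (r *\<^sub>R f :: 'a hsum) j = r *\<^sub>R hnth f j"
  by (simp add: scaleR_hsum_def hnth_Abs power_mult_distrib summable_mult summable_hnth)

instance
  by standard (auto intro!: hsum_eqI simp: algebra_simps)

end

lemma summable_inner_hnth:
  "summable (\<lambda>j. inner (hnth f j) (hnth (g :: 'a :: real_inner hsum) j))"
proof (rule summable_comparison_test'[of "\<lambda>j. (norm (hnth f j))\<^sup>2 + (norm (hnth g j))\<^sup>2" 0])
  fix j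
  have "norm (inner (hnth f j) (hnth g j)) \<le> norm (hnth f j) * norm (hnth g j)"
    by (simp add: Cauchy_Schwarz_ineq2)
  also have "\<dots> \<le> (norm (hnth f j))\<^sup>2 + (norm (hnth g j))\<^sup>2"
    using sum_squares_bound[of "norm (hnth f j)" "norm (hnth g j)"]
      mult_nonneg_nonneg[OF norm_ge_zero norm_ge_zero, of "hnth f j" "hnth g j"] by linarith
  finally show "norm (inner (hnth f j) (hnth g j)) \<le> (norm (hnth f j))\<^sup>2 + (norm (hnth g j))\<^sup>2" .
qed (intro summable_add summable_hnth)

instantiation hsum :: (real_inner) real_inner
begin

definition inner_hsum :: "'a hsum \<Rightarrow> 'a hsum \<Rightarrow> real"
  where "inner f g = (\<Sum>j. inner (hnth f j) (hnth g j))"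
definition norm_hsum :: "'a hsum \<Rightarrow> real" where "norm f = sqrt (inner f (f :: 'a hsum))"
definition sgn_hsum :: "'a hsum \<Rightarrow> 'a hsum" where "sgn f = f /\<^sub>R norm (f :: 'a hsum)"
definition dist_hsum :: "'a hsum \<Rightarrow> 'a hsum \<Rightarrow> real" where "dist f g = norm (f - g :: 'a hsum)"
definition uniformity_hsum :: "('a hsum \<times> 'a hsum) filter"
  where "uniformity_hsum = (INF e\<in>{0<..}. principal {(x, y). dist x y < e})"
definition open_hsum :: "'a hsum set \<Rightarrow> bool"
  where "open_hsum U = (\<forall>x\<in>U. \<forall>\<^sub>F (x', y) in uniformity. x' = x \<longrightarrow> y \<in> U)"

instance
proof
  fix f g h :: "'a hsum" and r :: real and U :: "'a hsum set"
  show "dist f g = norm (f - g)" by (rule dist_hsum_def)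
  show "sgn f = f /\<^sub>R norm f" by (rule sgn_hsum_def)
  show "uniformity = (INF e\<in>{0<..}. principal {(x, y :: 'a hsum). dist x y < e})"
    by (rule uniformity_hsum_def)
  show "open U = (\<forall>x\<in>U. \<forall>\<^sub>F (x', y) in uniformity. x' = x \<longrightarrow> y \<in> U)"
    by (rule open_hsum_def)
  show "norm f = sqrt (inner f f)" by (rule norm_hsum_def)
  show "inner f g = inner g f" by (simp add: inner_hsum_def inner_commute)
  show "inner (f + g) h = inner f h + inner g h"
    by (simp add: inner_hsum_def inner_add_left suminf_add summable_inner_hnth)
  show "inner (r *\<^sub>R f) g = r * inner f g"
    by (simp add: inner_hsum_def suminf_mult summable_inner_hnth)
  show "0 \<le> inner f f"
    by (simp add: inner_hsum_def suminf_nonneg summable_inner_hnth)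
  show "inner f f = 0 \<longleftrightarrow> f = 0"
  proof
    assume "inner f f = 0"
    then have "\<forall>j. inner (hnth f j) (hnth f j) = 0"
      using suminf_eq_zero_iff[OF summable_inner_hnth[of f f]] by (simp add: inner_hsum_def)
    then show "f = 0" by (intro hsum_eqI) simp
  qed (simp add: inner_hsum_def)
qed

end

lemma norm_hsum_sq: "(norm f)\<^sup>2 = (\<Sum>j. (norm (hnth (f :: 'a :: real_inner hsum) j))\<^sup>2)"
  using inner_ge_zero[of f] by (simp add: norm_hsum_def inner_hsum_def power2_norm_eq_inner)

lemma norm_hnth_le: "norm (hnth (f :: 'a :: real_inner hsum) j) \<le> norm f"
proof -
  have "(norm (hnth f j))\<^sup>2 = (\<Sum>i\<in>{j}. (norm (hnth f i))\<^sup>2)" by simp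
  also have "\<dots> \<le> (norm f)\<^sup>2"
    unfolding norm_hsum_sq by (rule sum_le_suminf) (auto simp: summable_hnth)
  finally show ?thesis by (simp add: power2_le_iff_abs_le)
qed

lemma summable_cinner_hnth:
  "summable (\<lambda>j. cinner (hnth f j) (hnth (g :: 'a :: complex_inner hsum) j))"
proof -
  have Im: "Im (cinner x y) = inner (- \<i> *\<^sub>C x) y" for x y :: 'a
    by (simp flip: Re_cinner add: cinner_scaleC_left)
  have "summable (\<lambda>j. (norm (- \<i> *\<^sub>C hnth f j))\<^sup>2)"
    by (simp add: norm_scaleC summable_hnth)
  then have "summable (\<lambda>j. inner (- \<i> *\<^sub>C hnth f j) (hnth g j))"
    using summable_inner_hnth[of "Abs_hsum (\<lambda>j. - \<i> *\<^sub>C hnth f j)" g] by (simp add: hnth_Abs)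
  then show ?thesis
    using summable_inner_hnth[of f g] by (simp add: summable_complex_iff Re_cinner Im)
qed

instantiation hsum :: (complex_inner) complex_inner
begin

definition scaleC_hsum :: "complex \<Rightarrow> 'a hsum \<Rightarrow> 'a hsum"
  where "scaleC_hsum a f = Abs_hsum (\<lambda>j. a *\<^sub>C hnth f j)"

definition cinner_hsum :: "'a hsum \<Rightarrow> 'a hsum \<Rightarrow> complex"
  where "cinner_hsum f g = (\<Sum>j. cinner (hnth f j) (hnth g j))"

lemma hnth_scaleC [simp]: "hnth (a *\<^sub>C f :: 'a hsum) j = a *\<^sub>C hnth f j"
  by (simp add: scaleC_hsum_def hnth_Abs norm_scaleC power_mult_distrib summable_mult summable_hnth)

instance
proof
  fix a b :: complex and r :: real and f g h :: "'a hsum"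
  show "a *\<^sub>C (f + g) = a *\<^sub>C f + a *\<^sub>C g"
    by (rule hsum_eqI) (simp add: scaleC_add_right)
  show "(a + b) *\<^sub>C f = a *\<^sub>C f + b *\<^sub>C f"
    by (rule hsum_eqI) (simp add: scaleC_add_left)
  show "a *\<^sub>C b *\<^sub>C f = (a * b) *\<^sub>C f"
    by (rule hsum_eqI) (simp add: scaleC_scaleC)
  show "r *\<^sub>R f = complex_of_real r *\<^sub>C f"
    by (rule hsum_eqI) (simp add: scaleR_scaleC)
  have "(\<lambda>j. cnj (cinner (hnth g j) (hnth f j))) sums cnj (cinner g f)"
    unfolding cinner_hsum_def sums_cnj by (rule summable_sums[OF summable_cinner_hnth])
  then show "cinner f g = cnj (cinner g f)"
    by (simp add: cinner_hsum_def sums_iff flip: cinner_commute)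
  show "cinner (f + g) h = cinner f h + cinner g h"
    by (simp add: cinner_hsum_def cinner_add_left suminf_add summable_cinner_hnth)
  show "cinner (a *\<^sub>C f) g = a * cinner f g"
    by (simp add: cinner_hsum_def cinner_scaleC_left suminf_mult summable_cinner_hnth)
  show "Re (cinner f g) = inner f g"
    by (simp add: cinner_hsum_def inner_hsum_def Re_suminf summable_cinner_hnth Re_cinner)
qed

end

instance hsum :: (chilbert_space) chilbert_space
proof
  fix X :: "nat \<Rightarrow> 'a hsum"
  assume X: "Cauchy X"
  have "Cauchy (\<lambda>i. hnth (X i) j)" for j
  proof (rule CauchyI)
    fix e :: real assume "0 < e"
    then obtain M where M: "\<And>m n. m \<ge> M \<Longrightarrow> n \<ge> M \<Longrightarrow> norm (X m - X n) < e"
      using X by (meson CauchyD)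
    have "norm (hnth (X m) j - hnth (X n) j) < e" if "m \<ge> M" "n \<ge> M" for m n
      using norm_hnth_le[of "X m - X n" j] M[OF that] by simp
    then show "\<exists>M. \<forall>m\<ge>M. \<forall>n\<ge>M. norm (hnth (X m) j - hnth (X n) j) < e" by blast
  qed
  then have "\<forall>j. \<exists>l. (\<lambda>i. hnth (X i) j) \<longlonglongrightarrow> l"
    using Cauchy_convergent convergent_def by blast
  then obtain l where l: "\<And>j. (\<lambda>i. hnth (X i) j) \<longlonglongrightarrow> l j" by metis
  have tail: "\<exists>M. \<forall>m\<ge>M. \<forall>N. (\<Sum>j<N. (norm (hnth (X m) j - l j))\<^sup>2) \<le> e\<^sup>2" if "0 < e" for e
  proof -
    obtain M where M: "\<And>m n. m \<ge> M \<Longrightarrow> n \<ge> M \<Longrightarrow> norm (X m - X n) < e"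
      using X \<open>0 < e\<close> by (meson CauchyD)
    have "(\<Sum>j<N. (norm (hnth (X m) j - l j))\<^sup>2) \<le> e\<^sup>2" if "m \<ge> M" for m N
    proof (rule LIMSEQ_le_const2)
      show "(\<lambda>n. \<Sum>j<N. (norm (hnth (X m) j - hnth (X n) j))\<^sup>2)
          \<longlonglongrightarrow> (\<Sum>j<N. (norm (hnth (X m) j - l j))\<^sup>2)"
        by (intro tendsto_intros l)
      have "(\<Sum>j<N. (norm (hnth (X m) j - hnth (X n) j))\<^sup>2) \<le> e\<^sup>2" if "n \<ge> M" for n
      proof -
        have "(\<Sum>j<N. (norm (hnth (X m - X n) j))\<^sup>2) \<le> (norm (X m - X n))\<^sup>2"
          unfolding norm_hsum_sq by (rule sum_le_suminf) (auto simp: summable_hnth simp del: hnth_diff)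
        also have "\<dots> \<le> e\<^sup>2"
          using M[OF \<open>m \<ge> M\<close> \<open>n \<ge> M\<close>] by (intro power_mono) auto
        finally show ?thesis by simp
      qed
      then show "\<exists>K. \<forall>n\<ge>K. (\<Sum>j<N. (norm (hnth (X m) j - hnth (X n) j))\<^sup>2) \<le> e\<^sup>2" by blast
    qed
    then show ?thesis by blast
  qed
  have diff: "summable (\<lambda>j. (norm (hnth (X m) j - l j))\<^sup>2)"
    if "\<forall>N. (\<Sum>j<N. (norm (hnth (X m) j - l j))\<^sup>2) \<le> c" for m c
    using that by (intro bounded_imp_summable[where B = c]) (simp_all del: sum.lessThan_Suc flip: lessThan_Suc_atMost)
  obtain M1 where M1: "\<forall>N. (\<Sum>j<N. (norm (hnth (X M1) j - l j))\<^sup>2) \<le> 1\<^sup>2"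
    using tail[of 1] by auto
  have "summable (\<lambda>j. (norm (hnth (X M1) j + (- (hnth (X M1) j - l j))))\<^sup>2)"
    by (intro summable_sq_add summable_hnth) (use diff[OF M1] in \<open>simp add: norm_minus_commute\<close>)
  then have "summable (\<lambda>j. (norm (l j))\<^sup>2)" by simp
  then have L: "hnth (Abs_hsum l) = l" by (rule hnth_Abs)
  have "X \<longlonglongrightarrow> Abs_hsum l"
  proof (rule LIMSEQ_I)
    fix r :: real assume "0 < r"
    then obtain M where M: "\<forall>m\<ge>M. \<forall>N. (\<Sum>j<N. (norm (hnth (X m) j - l j))\<^sup>2) \<le> (r / 2)\<^sup>2"
      using tail[of "r / 2"] by auto
    have "norm (X m - Abs_hsum l) < r" if "m \<ge> M" for m
    proof -
      have bd: "\<forall>N. (\<Sum>j<N. (norm (hnth (X m) j - l j))\<^sup>2) \<le> (r / 2)\<^sup>2"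
        using M that by blast
      then have "(\<Sum>j. (norm (hnth (X m) j - l j))\<^sup>2) \<le> (r / 2)\<^sup>2"
        by (intro suminf_le_const[OF diff[OF bd]]) blast
      then have "(norm (X m - Abs_hsum l))\<^sup>2 \<le> (r / 2)\<^sup>2"
        by (simp add: norm_hsum_sq L)
      then have "norm (X m - Abs_hsum l) \<le> r / 2"
        by (rule power2_le_imp_le) (use \<open>0 < r\<close> in simp)
      then show ?thesis using \<open>0 < r\<close> by linarith
    qed
    then show "\<exists>M. \<forall>m\<ge>M. norm (X m - Abs_hsum l) < r" by blast
  qed
  then show "convergent X" by (auto simp: convergent_def)
qed


section \<open>Operators between closed subspaces\<close>

text \<open>
  An operator from a closed subspace \<open>L\<close> to a closed subspace \<open>L'\<close> is a function on the
  ambient types, of which only the values on \<open>L\<close> matter. The inverse of a bijective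
  operator \<open>A\<close> on \<open>L\<close> is \<open>inv_into L A\<close>.
\<close>

definition bounded_op ::
    "'a::complex_inner set \<Rightarrow> 'b::complex_inner set \<Rightarrow> ('a \<Rightarrow> 'b) \<Rightarrow> bool" where
  "bounded_op L L' A \<longleftrightarrow>
     (\<forall>x\<in>L. A x \<in> L') \<and>
     (\<forall>x\<in>L. \<forall>y\<in>L. A (x + y) = A x + A y) \<and>
     (\<forall>c. \<forall>x\<in>L. A (c *\<^sub>C x) = c *\<^sub>C A x) \<and>
     (\<exists>K. \<forall>x\<in>L. norm (A x) \<le> K * norm x)"

definition onorm_on :: "'a::complex_inner set \<Rightarrow> ('a \<Rightarrow> 'b::complex_inner) \<Rightarrow> real" where
  "onorm_on L A = (SUP x\<in>L. norm (A x) / norm x)"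

definition invertible_op :: "'a::complex_inner set \<Rightarrow> ('a \<Rightarrow> 'a) \<Rightarrow> bool" where
  "invertible_op L A \<longleftrightarrow> bounded_op L L A \<and>
     (\<exists>B. bounded_op L L B \<and> (\<forall>x\<in>L. A (B x) = x \<and> B (A x) = x))"

definition orth_proj :: "'a::complex_inner set \<Rightarrow> 'a \<Rightarrow> 'a" where
  "orth_proj L x = (THE y. y \<in> L \<and> (\<forall>u\<in>L. cinner (x - y) u = 0))"

text \<open>\<open>adj L A\<close> is the adjoint of \<open>A\<close> as an operator with domain \<open>L\<close>.\<close>

definition adj :: "'a::complex_inner set \<Rightarrow> ('a \<Rightarrow> 'b::complex_inner) \<Rightarrow> 'b \<Rightarrow> 'a" where
  "adj L A y = (THE x. x \<in> L \<and> (\<forall>u\<in>L. cinner (A u) y = cinner u x))"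

text \<open>
  The nonnegative square root of a nonnegative operator \<open>R\<close> on \<open>L\<close>; the values off \<open>L\<close> are fixed
  only to make it unique as a function.
\<close>

definition sqrt_op :: "'a::complex_inner set \<Rightarrow> ('a \<Rightarrow> 'a) \<Rightarrow> 'a \<Rightarrow> 'a" where
  "sqrt_op L R = (THE B. bounded_op L L B \<and>
     (\<forall>x\<in>L. cinner (B x) x \<in> \<real> \<and> 0 \<le> Re (cinner (B x) x)) \<and>
     (\<forall>x\<in>L. B (B x) = R x) \<and> (\<forall>x. x \<notin> L \<longrightarrow> B x = 0))"

definition defect_op :: "'a::complex_inner set \<Rightarrow> ('a \<Rightarrow> 'b::complex_inner) \<Rightarrow> 'a \<Rightarrow> 'a" where
  "defect_op L A = sqrt_op L (\<lambda>x. x - adj L A (A x))"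

definition defect_space :: "'a::complex_inner set \<Rightarrow> ('a \<Rightarrow> 'b::complex_inner) \<Rightarrow> 'a set" where
  "defect_space L A = closure (defect_op L A ` L)"


section \<open>The Schur class and the Schur algorithm\<close>

text \<open>Holomorphy is complex differentiability in the operator norm at each point of the disc.\<close>

definition schur_class ::
    "'a::complex_inner set \<Rightarrow> 'b::complex_inner set \<Rightarrow> (complex \<Rightarrow> 'a \<Rightarrow> 'b) \<Rightarrow> bool" where
  "schur_class L L' \<Theta> \<longleftrightarrow>
     (\<forall>z\<in>ball 0 1. bounded_op L L' (\<Theta> z) \<and> onorm_on L (\<Theta> z) \<le> 1) \<and>
     (\<forall>z\<in>ball 0 1. \<exists>A. bounded_op L L' A \<and>
        ((\<lambda>w. onorm_on L (\<lambda>x. inverse (w - z) *\<^sub>C (\<Theta> w x - \<Theta> z x) - A x)) \<longlongrightarrow> 0) (at z))"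

text \<open>
  For a sequence \<open>\<Gamma>\<close> of Schur parameters, \<open>src \<Gamma> k\<close> and \<open>tgt \<Gamma> k\<close> are the initial and the final
  space of \<open>\<Gamma> k\<close>. With the shift by one, \<open>src \<Gamma> (Suc k)\<close> is the defect space of \<open>\<Gamma> k\<close> and
  \<open>tgt \<Gamma> (Suc k)\<close> is the defect space of its adjoint; these are closed subspaces of the two given
  Hilbert spaces, which are the types.
\<close>

primrec schur_spaces ::
    "(nat \<Rightarrow> 'm::complex_inner \<Rightarrow> 'n::complex_inner) \<Rightarrow> nat \<Rightarrow> 'm set \<times> 'n set" where
  "schur_spaces \<Gamma> 0 = (UNIV, UNIV)"
| "schur_spaces \<Gamma> (Suc k) =
     (defect_space (fst (schur_spaces \<Gamma> k)) (\<Gamma> k),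
      defect_space (snd (schur_spaces \<Gamma> k)) (adj (fst (schur_spaces \<Gamma> k)) (\<Gamma> k)))"

definition src :: "(nat \<Rightarrow> 'm::complex_inner \<Rightarrow> 'n::complex_inner) \<Rightarrow> nat \<Rightarrow> 'm set" where
  "src \<Gamma> k = fst (schur_spaces \<Gamma> k)"

definition tgt :: "(nat \<Rightarrow> 'm::complex_inner \<Rightarrow> 'n::complex_inner) \<Rightarrow> nat \<Rightarrow> 'n set" where
  "tgt \<Gamma> k = snd (schur_spaces \<Gamma> k)"

definition \<Gamma>adj :: "(nat \<Rightarrow> 'm::complex_inner \<Rightarrow> 'n::complex_inner) \<Rightarrow> nat \<Rightarrow> 'n \<Rightarrow> 'm" where
  "\<Gamma>adj \<Gamma> k = adj (src \<Gamma> k) (\<Gamma> k)"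

definition D\<Gamma> :: "(nat \<Rightarrow> 'm::complex_inner \<Rightarrow> 'n::complex_inner) \<Rightarrow> nat \<Rightarrow> 'm \<Rightarrow> 'm" where
  "D\<Gamma> \<Gamma> k = defect_op (src \<Gamma> k) (\<Gamma> k)"

definition D\<Gamma>adj :: "(nat \<Rightarrow> 'm::complex_inner \<Rightarrow> 'n::complex_inner) \<Rightarrow> nat \<Rightarrow> 'n \<Rightarrow> 'n" where
  "D\<Gamma>adj \<Gamma> k = defect_op (tgt \<Gamma> k) (\<Gamma>adj \<Gamma> k)"

text \<open>
  The Schur algorithm applied to \<open>\<Theta>\<close> yields the associated functions \<open>\<Theta>s k\<close> and the
  parameters \<open>\<Gamma> k\<close>.
\<close>

definition schur_algorithm ::
    "(complex \<Rightarrow> 'm::complex_inner \<Rightarrow> 'n::complex_inner) \<Rightarrow>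
     (nat \<Rightarrow> complex \<Rightarrow> 'm \<Rightarrow> 'n) \<Rightarrow> (nat \<Rightarrow> 'm \<Rightarrow> 'n) \<Rightarrow> bool" where
  "schur_algorithm \<Theta> \<Theta>s \<Gamma> \<longleftrightarrow>
     \<Theta>s 0 = \<Theta> \<and>
     (\<forall>k. \<Gamma> k = \<Theta>s k 0) \<and>
     (\<forall>k. schur_class (src \<Gamma> (Suc k)) (tgt \<Gamma> (Suc k)) (\<Theta>s (Suc k))) \<and>
     (\<forall>k. \<forall>z\<in>ball 0 1. \<forall>x\<in>src \<Gamma> k.
        \<Theta>s k z x = \<Gamma> k x + z *\<^sub>C D\<Gamma>adj \<Gamma> k (\<Theta>s (Suc k) z
          (inv_into (src \<Gamma> (Suc k)) (\<lambda>u. u + z *\<^sub>C \<Gamma>adj \<Gamma> k (\<Theta>s (Suc k) z u)) (D\<Gamma> \<Gamma> k x))))"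


section \<open>Truncated block operator CMV matrices\<close>

text \<open>
  The entry with index \<open>j\<close> of a sequence is its component in the summand with number \<open>j + 1\<close>, so
  the sums over \<open>k = 1, \<dots>, n + 1\<close> correspond to the indices \<open>j \<le> n\<close>. The suffix \<open>t\<close> stands for a
  tilde. The operators below are meant on \<open>HH \<Gamma>\<close>, \<open>HHt \<Gamma>\<close> and their subspaces, where \<open>rot \<Gamma> k\<close> is
  isometric and the sequences passed to \<open>Abs_hsum\<close> are square summable.
\<close>

definition rot ::
    "(nat \<Rightarrow> 'm::complex_inner \<Rightarrow> 'n::complex_inner) \<Rightarrow> nat \<Rightarrow> 'm \<times> 'n \<Rightarrow> 'n \<times> 'm" where
  "rot \<Gamma> k = (\<lambda>(x, y). (\<Gamma> k x + D\<Gamma>adj \<Gamma> k y, D\<Gamma> \<Gamma> k x - \<Gamma>adj \<Gamma> k y))"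

definition HH :: "(nat \<Rightarrow> 'm::complex_inner \<Rightarrow> 'n::complex_inner) \<Rightarrow> ('m \<times> 'n) hsum set" where
  "HH \<Gamma> = {f. \<forall>j. hnth f j \<in> src \<Gamma> (2*j + 1) \<times> tgt \<Gamma> (2*j + 2)}"

definition HHt :: "(nat \<Rightarrow> 'm::complex_inner \<Rightarrow> 'n::complex_inner) \<Rightarrow> ('n \<times> 'm) hsum set" where
  "HHt \<Gamma> = {g. \<forall>j. hnth g j \<in> tgt \<Gamma> (2*j + 1) \<times> src \<Gamma> (2*j + 2)}"

definition KK ::
    "(nat \<Rightarrow> 'm::complex_inner \<Rightarrow> 'n::complex_inner) \<Rightarrow> nat \<Rightarrow> ('m \<times> 'n) hsum set" where
  "KK \<Gamma> n = {f \<in> HH \<Gamma>. \<forall>j>n. hnth f j = 0}"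

definition KKt ::
    "(nat \<Rightarrow> 'm::complex_inner \<Rightarrow> 'n::complex_inner) \<Rightarrow> nat \<Rightarrow> ('n \<times> 'm) hsum set" where
  "KKt \<Gamma> n = {g \<in> HHt \<Gamma>. \<forall>j>n. hnth g j = 0}"

definition V0 ::
    "(nat \<Rightarrow> 'm::complex_inner \<Rightarrow> 'n::complex_inner) \<Rightarrow> ('m \<times> 'n) hsum \<Rightarrow> ('n \<times> 'm) hsum" where
  "V0 \<Gamma> f = Abs_hsum (\<lambda>j. rot \<Gamma> (2*j + 1) (hnth f j))"

definition Vn ::
    "(nat \<Rightarrow> 'm::complex_inner \<Rightarrow> 'n::complex_inner) \<Rightarrow> nat \<Rightarrow>
     ('m \<times> 'n) hsum \<Rightarrow> ('n \<times> 'm) hsum" where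
  "Vn \<Gamma> n f = Abs_hsum (\<lambda>j. if j \<le> n then rot \<Gamma> (2*j + 1) (hnth f j) else 0)"

text \<open>
  In the regrouped decompositions the block with even index \<open>2*k\<close>, \<open>k \<ge> 1\<close>, acts on
  the second component of the entry \<open>k - 1\<close> and the first component of the entry \<open>k\<close>, and
  yields the corresponding components of the image.
\<close>

definition even_block ::
    "(nat \<Rightarrow> 'm::complex_inner \<Rightarrow> 'n::complex_inner) \<Rightarrow> nat \<Rightarrow> ('n \<times> 'm) hsum \<Rightarrow> 'n \<times> 'm" where
  "even_block \<Gamma> k g = rot \<Gamma> (2*k) (snd (hnth g (k - 1)), fst (hnth g k))"

definition W0 ::
    "(nat \<Rightarrow> 'm::complex_inner \<Rightarrow> 'n::complex_inner) \<Rightarrow> ('n \<times> 'm) hsum \<Rightarrow> ('m \<times> 'n) hsum" where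
  "W0 \<Gamma> g = Abs_hsum (\<lambda>j.
     (if j = 0 then - \<Gamma>adj \<Gamma> 0 (fst (hnth g 0)) else snd (even_block \<Gamma> j g),
      fst (even_block \<Gamma> (j + 1) g)))"

definition Wn ::
    "(nat \<Rightarrow> 'm::complex_inner \<Rightarrow> 'n::complex_inner) \<Rightarrow> nat \<Rightarrow> ('m \<Rightarrow> 'n) \<Rightarrow>
     ('n \<times> 'm) hsum \<Rightarrow> ('m \<times> 'n) hsum" where
  "Wn \<Gamma> n G g = Abs_hsum (\<lambda>j. if j \<le> n then
     (if j = 0 then - \<Gamma>adj \<Gamma> 0 (fst (hnth g 0)) else snd (even_block \<Gamma> j g),
      if j < n then fst (even_block \<Gamma> (j + 1) g) else G (snd (hnth g n))) else 0)"

definition T0 ::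
    "(nat \<Rightarrow> 'm::complex_inner \<Rightarrow> 'n::complex_inner) \<Rightarrow> ('m \<times> 'n) hsum \<Rightarrow> ('m \<times> 'n) hsum" where
  "T0 \<Gamma> = W0 \<Gamma> \<circ> V0 \<Gamma>"

definition T0t ::
    "(nat \<Rightarrow> 'm::complex_inner \<Rightarrow> 'n::complex_inner) \<Rightarrow> ('n \<times> 'm) hsum \<Rightarrow> ('n \<times> 'm) hsum" where
  "T0t \<Gamma> = V0 \<Gamma> \<circ> W0 \<Gamma>"

definition Sn ::
    "(nat \<Rightarrow> 'm::complex_inner \<Rightarrow> 'n::complex_inner) \<Rightarrow> nat \<Rightarrow> ('m \<Rightarrow> 'n) \<Rightarrow>
     ('m \<times> 'n) hsum \<Rightarrow> ('m \<times> 'n) hsum" where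
  "Sn \<Gamma> n G = Wn \<Gamma> n G \<circ> Vn \<Gamma> n"

definition Snt ::
    "(nat \<Rightarrow> 'm::complex_inner \<Rightarrow> 'n::complex_inner) \<Rightarrow> nat \<Rightarrow> ('m \<Rightarrow> 'n) \<Rightarrow>
     ('n \<times> 'm) hsum \<Rightarrow> ('n \<times> 'm) hsum" where
  "Snt \<Gamma> n G = Vn \<Gamma> n \<circ> Wn \<Gamma> n G"

end

theory Submission
  imports Defs
begin

text \<open>
  Put \<open>m = 2n + 2\<close>. The operator \<open>\<V>\<^sub>0\<close> acts entry by entry, so it respects the decomposition of
  the sequence space into the entries up to \<open>n\<close> and the later ones. In \<open>\<T>\<^sub>0 h\<close> the operator \<open>\<W>\<^sub>0\<close>
  couples the two parts only through the rotation of \<open>\<Gamma>\<^sub>m\<close>, which receives the second component \<open>u\<close> of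
  entry \<open>n\<close> of \<open>\<V>\<^sub>0 h\<close> and the first component of its entry \<open>n + 1\<close>. Solving \<open>(I - z \<T>\<^sub>0) h = f\<close> with \<open>f\<close>
  supported on the entries up to \<open>n\<close> therefore means solving a homogeneous system on the later
  entries with input \<open>u\<close>; its output, the first component of the rotation of \<open>\<Gamma>\<^sub>m\<close>, is all that
  the first entries see of the rest. The theorem says that this output is \<open>\<Theta>\<^sub>m(z) u\<close>.

  The reason is that one step of the Schur algorithm is one elementary rotation: if
  \<open>x = (I + z \<Gamma>\<^sub>k\<^sup>* \<Theta>\<^sub>k\<^sub>+\<^sub>1(z))\<^sup>-\<^sup>1 D u\<close>, where \<open>D\<close> is the defect operator of \<open>\<Gamma>\<^sub>k\<close>, then the
  rotation of \<open>\<Gamma>\<^sub>k\<close> maps \<open>(u, z \<Theta>\<^sub>k\<^sub>+\<^sub>1(z) x)\<close> to \<open>(\<Theta>\<^sub>k(z) u, x)\<close> (lemma \<open>rot_next_vec\<close>).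
  Iterating from \<open>k = m\<close> gives an explicit solution of the homogeneous system with the required
  output (lemma \<open>W0_extend\<close>). It is square summable because the rotations preserve norms: the
  resulting identities between the quantities \<open>\<parallel>u\<parallel>\<^sup>2 - \<parallel>\<Theta>\<^sub>k(z) u\<parallel>\<^sup>2\<close>, which are nonnegative,
  telescope (lemma \<open>chain_energy\<close>). Hence the solution \<open>p\<close> of the truncated equation, continued
  by this tail, solves the full equation, and the projection cuts the tail off again (lemmas
  \<open>resolvent_T0\<close> and \<open>resolvent_T0t\<close>). Uniqueness of the solutions is the invertibility of
  \<open>I - z C\<close> for a contraction \<open>C\<close> and \<open>|z| < 1\<close>.

  Norm preservation of the rotations rests on the intertwining relation \<open>G D\<^sub>G = D\<^sub>G\<^sub>* G\<close> for a
  contraction \<open>G\<close>. Adjoints come from the Riesz representation, and the square root in a defect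
  operator is obtained from the binomial series of \<open>\<surd>(1 - t)\<close>; an operator that
  intertwines two contractions also intertwines their series.
\<close>

section \<open>Operators between closed subspaces\<close>

instance chilbert_space \<subseteq> banach ..

subsection \<open>The complex inner product\<close>

lemma scaleC_zero_right [simp]: "a *\<^sub>C 0 = (0 :: 'a :: complex_inner)"
  using scaleC_add_right[of a 0 "0 :: 'a"] by simp

lemma scaleC_minus_one: "(- 1) *\<^sub>C x = - (x :: 'a :: complex_inner)"
  using scaleR_scaleC[of "- 1" x] by simp

lemma scaleC_minus_right: "a *\<^sub>C (- x) = - (a *\<^sub>C (x :: 'a :: complex_inner))"
  using scaleC_add_right[of a x "- x"] by (simp add: eq_neg_iff_add_eq_0 add.commute)

lemma scaleC_diff_right: "a *\<^sub>C (x - y) = a *\<^sub>C x - a *\<^sub>C (y :: 'a :: complex_inner)"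
  using scaleC_add_right[of a x "- y"] by (simp add: scaleC_minus_right)

lemma bounded_linear_scaleC: "bounded_linear (\<lambda>x :: 'a :: complex_inner. c *\<^sub>C x)"
  by (rule bounded_linear_intro[of _ "cmod c"])
     (simp_all add: scaleC_add_right scaleR_scaleC scaleC_scaleC mult.commute norm_scaleC)

lemma cinner_diff_left: "cinner (x - y) w = cinner x w - cinner y (w :: 'a :: complex_inner)"
  using cinner_add_left[of "x - y" y w] by simp

lemma cinner_zero_left [simp]: "cinner 0 (w :: 'a :: complex_inner) = 0"
  using cinner_diff_left[of 0 0 w] by simp

lemma cinner_zero_right [simp]: "cinner (w :: 'a :: complex_inner) 0 = 0"
  using cinner_commute[of w 0] by simp

lemma cinner_add_right: "cinner w (x + y) = cinner w x + cinner w (y :: 'a :: complex_inner)"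
  by (metis cinner_add_left cinner_commute complex_cnj_add)

lemma cinner_scaleC_right: "cinner x (a *\<^sub>C y) = cnj a * cinner x (y :: 'a :: complex_inner)"
  by (metis cinner_scaleC_left cinner_commute complex_cnj_mult)

lemma Im_cinner: "Im (cinner x y) = - inner (\<i> *\<^sub>C x) (y :: 'a :: complex_inner)"
  unfolding Re_cinner[symmetric] cinner_scaleC_left by simp

text \<open>
  The imaginary part of the complex inner product is, up to sign, the real inner product with
  \<open>\<i> x\<close>. On complex subspaces identities between complex inner products thus reduce to real
  ones.
\<close>

lemma cinner_eq_iff_inner:
  fixes x y :: "'a :: complex_inner" and x' y' :: "'b :: complex_inner"
  shows "cinner x y = cinner x' y' \<longleftrightarrow>
    inner x y = inner x' y' \<and> inner (\<i> *\<^sub>C x) y = inner (\<i> *\<^sub>C x') y'"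
  by (auto simp: complex_eq_iff Re_cinner Im_cinner)


subsection \<open>Subspaces, bounded operators and contractions\<close>

definition closed_csubspace :: "'a::complex_inner set \<Rightarrow> bool" where
  "closed_csubspace L \<longleftrightarrow> closed L \<and> 0 \<in> L \<and> (\<forall>x\<in>L. \<forall>y\<in>L. x + y \<in> L) \<and> (\<forall>c. \<forall>x\<in>L. c *\<^sub>C x \<in> L)"

lemma closed_csubspaceD:
  assumes "closed_csubspace L"
  shows "closed L" "0 \<in> L" "x \<in> L \<Longrightarrow> y \<in> L \<Longrightarrow> x + y \<in> L" "x \<in> L \<Longrightarrow> c *\<^sub>C x \<in> L"
    "x \<in> L \<Longrightarrow> - x \<in> L" "x \<in> L \<Longrightarrow> y \<in> L \<Longrightarrow> x - y \<in> L" "x \<in> L \<Longrightarrow> r *\<^sub>R x \<in> L"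
proof -
  show c: "closed L" "0 \<in> L" "\<And>x y. x \<in> L \<Longrightarrow> y \<in> L \<Longrightarrow> x + y \<in> L"
    "\<And>c x. x \<in> L \<Longrightarrow> c *\<^sub>C x \<in> L"
    using assms by (auto simp: closed_csubspace_def)
  show m: "- x \<in> L" if "x \<in> L" for x
    using c(4)[OF that, of "- 1"] by (simp add: scaleC_minus_one)
  show "x - y \<in> L" if "x \<in> L" "y \<in> L" for x y
    using c(3)[OF that(1) m[OF that(2)]] by simp
  show "r *\<^sub>R x \<in> L" if "x \<in> L"
    using c(4)[OF that] by (simp add: scaleR_scaleC)
qed

lemma closed_csubspace_UNIV: "closed_csubspace UNIV"
  by (simp add: closed_csubspace_def)

lemma closed_csubspace_Times:
  "closed_csubspace L \<Longrightarrow> closed_csubspace M \<Longrightarrow> closed_csubspace (L \<times> M)"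
  by (auto simp: closed_csubspace_def closed_Times scaleC_prod_def zero_prod_def)

lemma bounded_opD:
  assumes "bounded_op L L' A"
  shows "x \<in> L \<Longrightarrow> A x \<in> L'" "x \<in> L \<Longrightarrow> y \<in> L \<Longrightarrow> A (x + y) = A x + A y"
    "x \<in> L \<Longrightarrow> A (c *\<^sub>C x) = c *\<^sub>C A x" "x \<in> L \<Longrightarrow> A (r *\<^sub>R x) = r *\<^sub>R A x"
    "x \<in> L \<Longrightarrow> A (- x) = - A x"
  using assms unfolding bounded_op_def
  by (simp_all add: scaleR_scaleC flip: scaleC_minus_one)

lemma bounded_op_diff:
  assumes "closed_csubspace L" "bounded_op L L' A" "x \<in> L" "y \<in> L"
  shows "A (x - y) = A x - A y"
  using bounded_opD(2,5)[OF assms(2)] assms(3,4) closed_csubspaceD(5)[OF assms(1) assms(4)]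
  by (metis add_uminus_conv_diff)

lemma bounded_op_zero: "closed_csubspace L \<Longrightarrow> bounded_op L L' A \<Longrightarrow> A 0 = 0"
  using bounded_opD(4)[of L L' A 0 0] by (simp add: closed_csubspaceD)

lemma bounded_op_sum:
  assumes L: "closed_csubspace L" and A: "bounded_op L L' A" and "finite I" "\<And>i. i \<in> I \<Longrightarrow> f i \<in> L"
  shows "sum f I \<in> L \<and> A (sum f I) = (\<Sum>i\<in>I. A (f i))"
  using assms(3,4)
  by (induction I)
     (auto simp: bounded_op_zero[OF L A] closed_csubspaceD[OF L] bounded_opD[OF A])

text \<open>
  An operator is linear and bounded on its domain only: the partial sums stay in the domain
  because it is a subspace, and the limit because it is closed.
\<close>

lemma bounded_op_sums:
  assumes L: "closed_csubspace L" and A: "bounded_op L L' A" and f: "\<And>i. f i \<in> L" "f sums s"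
  shows "s \<in> L" "(\<lambda>i. A (f i)) sums A s"
proof -
  have part: "sum f {..<N} \<in> L" "A (sum f {..<N}) = (\<Sum>i<N. A (f i))" for N
    using bounded_op_sum[OF L A, of "{..<N}" f] f(1) by auto
  have lim: "(\<lambda>N. sum f {..<N}) \<longlonglongrightarrow> s" using f(2) by (simp add: sums_def)
  show s: "s \<in> L"
    using closed_sequentially[OF closed_csubspaceD(1)[OF L] _ lim] part(1) by blast
  obtain K where K: "\<And>x. x \<in> L \<Longrightarrow> norm (A x) \<le> K * norm x"
    using A unfolding bounded_op_def by blast
  have "(\<lambda>N. A (sum f {..<N}) - A s) \<longlonglongrightarrow> 0"
  proof (rule Lim_null_comparison)
    have "norm (A (sum f {..<N}) - A s) \<le> K * norm (sum f {..<N} - s)" for N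
      using K[of "sum f {..<N} - s"] part(1)[of N] s closed_csubspaceD(6)[OF L]
      by (simp add: bounded_op_diff[OF L A])
    then show "\<forall>\<^sub>F N in sequentially. norm (A (sum f {..<N}) - A s) \<le> K * norm (sum f {..<N} - s)"
      by simp
    show "(\<lambda>N. K * norm (sum f {..<N} - s)) \<longlonglongrightarrow> 0"
      using lim by (auto intro!: tendsto_eq_intros simp: LIM_zero)
  qed
  then show "(\<lambda>i. A (f i)) sums A s"
    by (simp add: sums_def part(2) LIM_zero_iff)
qed

definition contraction_op ::
    "'a::complex_inner set \<Rightarrow> 'b::complex_inner set \<Rightarrow> ('a \<Rightarrow> 'b) \<Rightarrow> bool" where
  "contraction_op L L' A \<longleftrightarrow> bounded_op L L' A \<and> (\<forall>x\<in>L. norm (A x) \<le> norm x)"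

lemma contraction_opI:
  assumes "\<And>x. x \<in> L \<Longrightarrow> A x \<in> L'" "\<And>x y. x \<in> L \<Longrightarrow> y \<in> L \<Longrightarrow> A (x + y) = A x + A y"
    "\<And>c x. x \<in> L \<Longrightarrow> A (c *\<^sub>C x) = c *\<^sub>C A x" "\<And>x. x \<in> L \<Longrightarrow> norm (A x) \<le> norm x"
  shows "contraction_op L L' A"
  unfolding contraction_op_def bounded_op_def using assms by (auto intro!: exI[of _ 1])

lemma contraction_opD:
  assumes "contraction_op L L' A"
  shows "bounded_op L L' A" "x \<in> L \<Longrightarrow> norm (A x) \<le> norm x"
  using assms by (auto simp: contraction_op_def)

lemma contraction_op_comp:
  assumes A: "contraction_op L L' A" and B: "contraction_op L' L'' B"
  shows "contraction_op L L'' (B \<circ> A)"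
proof (rule contraction_opI)
  note lin = bounded_opD[OF contraction_opD(1)[OF A]] bounded_opD[OF contraction_opD(1)[OF B]]
  fix x y c assume x: "x \<in> L"
  show "(B \<circ> A) x \<in> L''" "(B \<circ> A) (c *\<^sub>C x) = c *\<^sub>C (B \<circ> A) x"
    using x by (simp_all add: lin)
  show "(B \<circ> A) (x + y) = (B \<circ> A) x + (B \<circ> A) y" if "y \<in> L"
    using x that by (simp add: lin)
  show "norm ((B \<circ> A) x) \<le> norm x"
    using contraction_opD(2)[OF B lin(1)[OF x]] contraction_opD(2)[OF A x] by simp
qed

text \<open>
  The quotient in \<open>onorm_on\<close> at the zero vector is \<open>0 / 0 = 0\<close>, hence harmless. The supremum
  bounds the quotients only if they are bounded above, which is where boundedness of \<open>A\<close> enters.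
\<close>

lemma contraction_op_of_onorm_on:
  assumes A: "bounded_op L L' A" and le: "onorm_on L A \<le> 1"
  shows "contraction_op L L' A"
proof -
  obtain K where K: "\<And>x. x \<in> L \<Longrightarrow> norm (A x) \<le> K * norm x"
    using A unfolding bounded_op_def by blast
  have bdd: "bdd_above ((\<lambda>x. norm (A x) / norm x) ` L)"
  proof (rule bdd_aboveI2)
    fix x assume "x \<in> L"
    then have "norm (A x) \<le> max K 0 * norm x"
      using K[of x] mult_right_mono[of K "max K 0" "norm x"] by simp
    then show "norm (A x) / norm x \<le> max K 0"
      by (cases "x = 0") (auto simp: divide_simps)
  qed
  have "norm (A x) \<le> norm x" if x: "x \<in> L" for x
  proof (cases "x = 0")
    case True
    then show ?thesis using K[OF x] by simp
  next
    case False
    have "norm (A x) / norm x \<le> onorm_on L A"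
      unfolding onorm_on_def by (rule cSUP_upper[OF x bdd])
    then have "norm (A x) / norm x \<le> 1" using le by linarith
    then show ?thesis using False by (simp add: divide_simps split: if_splits)
  qed
  then show ?thesis using A by (simp add: contraction_op_def)
qed


subsection \<open>Riesz representation and the adjoint\<close>

lemma quadratic_nonneg_imp_zero:
  fixes b c :: real
  assumes "\<And>t. 0 \<le> 2 * t * c + t\<^sup>2 * b"
  shows "c = 0"
proof (rule ccontr)
  assume "c \<noteq> 0"
  \<comment> \<open>At \<open>t = - c / d\<close> the linear term outweighs the quadratic one.\<close>
  define d where "d = \<bar>b\<bar> + 1"
  have d: "d > 0" "b \<le> d" by (auto simp: d_def)
  have "0 \<le> 2 * (- c / d) * c + (- c / d)\<^sup>2 * b" by (rule assms)
  also have "\<dots> \<le> 2 * (- c / d) * c + (- c / d)\<^sup>2 * d"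
    using d by (intro add_left_mono mult_left_mono) auto
  also have "\<dots> = - (c\<^sup>2 / d)"
    using d by (simp add: field_simps power2_eq_square)
  also have "\<dots> < 0" using d \<open>c \<noteq> 0\<close> by simp
  finally show False by simp
qed

text \<open>
  The representing vector minimises \<open>\<parallel>u\<parallel>\<^sup>2 - 2 \<phi> u\<close> over \<open>L\<close>; completeness provides the
  minimiser.
\<close>

lemma riesz_representation:
  fixes L :: "'a :: chilbert_space set" and \<phi> :: "'a \<Rightarrow> real"
  assumes L: "closed_csubspace L"
    and add: "\<And>x y. x \<in> L \<Longrightarrow> y \<in> L \<Longrightarrow> \<phi> (x + y) = \<phi> x + \<phi> y"
    and scale: "\<And>r x. x \<in> L \<Longrightarrow> \<phi> (r *\<^sub>R x) = r * \<phi> x"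
    and bound: "\<And>x. x \<in> L \<Longrightarrow> \<bar>\<phi> x\<bar> \<le> K * norm x"
  shows "\<exists>x\<in>L. \<forall>u\<in>L. inner u x = \<phi> u"
proof -
  note LD = closed_csubspaceD[OF L]
  define J where "J u = (norm u)\<^sup>2 - 2 * \<phi> u" for u
  define d where "d = Inf (J ` L)"
  have "- (K\<^sup>2) \<le> J u" if "u \<in> L" for u
  proof -
    have "0 \<le> (norm u - K)\<^sup>2" by simp
    then show ?thesis using bound[OF that] by (simp add: J_def power2_diff algebra_simps)
  qed
  then have bdd: "bdd_below (J ` L)" by (intro bdd_belowI2)
  have d: "d \<le> J u" if "u \<in> L" for u
    unfolding d_def by (rule cINF_lower[OF bdd that])
  have "\<exists>u\<in>L. J u < d + inverse (real (Suc i))" for i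
    using cInf_lessD[of "J ` L" "d + inverse (real (Suc i))"] LD(2)
    unfolding d_def by fastforce
  then obtain u where u: "\<And>i. u i \<in> L" "\<And>i. J (u i) < d + inverse (real (Suc i))"
    by metis
  \<comment> \<open>Parallelogram law, applied to the midpoint of two near-minimisers.\<close>
  have near: "(norm (v - w))\<^sup>2 \<le> 2 * (J v - d) + 2 * (J w - d)" if "v \<in> L" "w \<in> L" for v w
  proof -
    have "d \<le> J ((1/2) *\<^sub>R (v + w))" using that by (intro d LD)
    also have "\<dots> = (norm (v + w))\<^sup>2 / 4 - \<phi> v - \<phi> w"
      using that by (simp add: J_def scale add LD power_divide add_divide_distrib del: scaleR_add_right)
    finally show ?thesis
      by (simp add: J_def power2_norm_eq_inner inner_add inner_diff inner_commute algebra_simps)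
  qed
  have small: "norm (u i - u j) < e"
    if "0 < e" "N > 0" "inverse (real N) < e\<^sup>2 / 4" "N \<le> i" "N \<le> j" for e N i j
  proof -
    have "inverse (real (Suc k)) \<le> inverse (real N)" if "N \<le> k" for k
      using that \<open>N > 0\<close> by (intro le_imp_inverse_le) auto
    then have "J (u i) - d < e\<^sup>2 / 4" "J (u j) - d < e\<^sup>2 / 4"
      using u(2)[of i] u(2)[of j] that by (smt (verit))+
    then have "(norm (u i - u j))\<^sup>2 < e\<^sup>2"
      using near[OF u(1) u(1), of i j] by (simp add: field_simps)
    then show ?thesis using \<open>0 < e\<close> by (simp add: power2_less_imp_less)
  qed
  have "Cauchy u"
  proof (rule CauchyI)
    fix e :: real assume "0 < e"
    then obtain N where "N > 0" "inverse (real N) < e\<^sup>2 / 4"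
      using ex_inverse_of_nat_less[of "e\<^sup>2 / 4"] by auto
    then show "\<exists>M. \<forall>m\<ge>M. \<forall>n\<ge>M. norm (u m - u n) < e"
      using small[OF \<open>0 < e\<close>] by blast
  qed
  then obtain x where x: "u \<longlonglongrightarrow> x"
    using Cauchy_convergent convergent_def by blast
  have "x \<in> L" using closed_sequentially[OF LD(1) _ x] u(1) by blast
  moreover have "inner w x = \<phi> w" if w: "w \<in> L" for w
  proof -
    \<comment> \<open>The first variation of \<open>J\<close> vanishes at \<open>x\<close>; only limits of inner products are taken.\<close>
    have "0 \<le> 2 * t * (inner w x - \<phi> w) + t\<^sup>2 * (norm w)\<^sup>2" for t
    proof (rule LIMSEQ_le)
      show "(\<lambda>i. - inverse (real (Suc i))) \<longlonglongrightarrow> 0"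
        using tendsto_minus[OF LIMSEQ_inverse_real_of_nat] by simp
      show "(\<lambda>i. 2 * t * (inner w (u i) - \<phi> w) + t\<^sup>2 * (norm w)\<^sup>2)
          \<longlonglongrightarrow> 2 * t * (inner w x - \<phi> w) + t\<^sup>2 * (norm w)\<^sup>2"
        by (intro tendsto_intros x)
      have "- inverse (real (Suc i)) \<le> 2 * t * (inner w (u i) - \<phi> w) + t\<^sup>2 * (norm w)\<^sup>2" for i
      proof -
        have "d \<le> J (u i + t *\<^sub>R w)" using u w by (intro d LD)
        also have "\<dots> = J (u i) + 2 * t * (inner w (u i) - \<phi> w) + t\<^sup>2 * (norm w)\<^sup>2"
          using u(1)[of i] w unfolding J_def power2_norm_eq_inner
          by (simp add: add scale LD inner_add inner_commute algebra_simps power2_eq_square)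
        finally show ?thesis using u(2)[of i] by linarith
      qed
      then show "\<exists>N. \<forall>n\<ge>N. - inverse (real (Suc n))
          \<le> 2 * t * (inner w (u n) - \<phi> w) + t\<^sup>2 * (norm w)\<^sup>2" by blast
    qed
    then have "inner w x - \<phi> w = 0" by (rule quadratic_nonneg_imp_zero)
    then show ?thesis by simp
  qed
  ultimately show ?thesis by blast
qed

lemma adj_unique:
  assumes L: "closed_csubspace L" and x: "x \<in> L" "\<And>u. u \<in> L \<Longrightarrow> cinner (A u) y = cinner u x"
  shows "adj L A y = x"
  unfolding adj_def
proof (rule the_equality)
  show "x \<in> L \<and> (\<forall>u\<in>L. cinner (A u) y = cinner u x)" using x by blast
  fix x' assume x': "x' \<in> L \<and> (\<forall>u\<in>L. cinner (A u) y = cinner u x')"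
  have "x' - x \<in> L" using x x' by (intro closed_csubspaceD[OF L]) auto
  then have "inner (x' - x) x' = inner (x' - x) x"
    using x(2)[of "x' - x"] x' by (metis Re_cinner)
  then have "inner (x' - x) (x' - x) = 0" by (simp add: inner_diff_right)
  then show "x' = x" by simp
qed

text \<open>
  Riesz represents the real functional \<open>u \<mapsto> Re \<langle>A u, y\<rangle>\<close>; replacing \<open>u\<close> by \<open>\<i> u\<close> recovers the
  imaginary part.
\<close>

lemma adj_props:
  fixes A :: "'a :: chilbert_space \<Rightarrow> 'b :: complex_inner"
  assumes L: "closed_csubspace L" and A: "bounded_op L L' A"
  shows "adj L A y \<in> L" "u \<in> L \<Longrightarrow> cinner (A u) y = cinner u (adj L A y)"
proof -
  obtain K where K: "\<And>x. x \<in> L \<Longrightarrow> norm (A x) \<le> K * norm x"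
    using A unfolding bounded_op_def by blast
  have "\<exists>x\<in>L. \<forall>u\<in>L. inner u x = inner (A u) y"
  proof (rule riesz_representation[OF L, where K = "K * norm y"])
    fix u assume "u \<in> L"
    then have "norm (A u) * norm y \<le> K * norm u * norm y"
      using K by (intro mult_right_mono) auto
    then show "\<bar>inner (A u) y\<bar> \<le> K * norm y * norm u"
      using Cauchy_Schwarz_ineq2[of "A u" y] by (simp add: mult_ac)
  qed (simp_all add: bounded_opD[OF A] inner_add_left)
  then obtain x where x: "x \<in> L" "\<And>u. u \<in> L \<Longrightarrow> inner u x = inner (A u) y" by blast
  have "cinner (A u) y = cinner u x" if "u \<in> L" for u
    using x(2)[of u] x(2)[of "\<i> *\<^sub>C u"] that closed_csubspaceD(4)[OF L that, of \<i>]
    by (simp add: cinner_eq_iff_inner bounded_opD[OF A])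
  then have "adj L A y = x" and c: "\<And>u. u \<in> L \<Longrightarrow> cinner (A u) y = cinner u x"
    using adj_unique[OF L x(1)] by blast+
  then show "adj L A y \<in> L" "u \<in> L \<Longrightarrow> cinner (A u) y = cinner u (adj L A y)"
    using x(1) by auto
qed

lemma adj_adjoint_inner:
  fixes A :: "'a :: chilbert_space \<Rightarrow> 'b :: complex_inner"
  assumes "closed_csubspace L" "bounded_op L L' A" "u \<in> L"
  shows "inner (A u) y = inner u (adj L A y)"
  using adj_props(2)[OF assms(1,2,3)] by (metis Re_cinner)

lemma contraction_op_adj:
  fixes A :: "'a :: chilbert_space \<Rightarrow> 'b :: complex_inner"
  assumes L: "closed_csubspace L" and A: "contraction_op L L' A"
  shows "contraction_op L' L (adj L A)"
proof (rule contraction_opI)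
  note B = contraction_opD(1)[OF A]
  note P = adj_props[OF L B]
  fix x y c
  show "adj L A x \<in> L" by (rule P)
  show "adj L A (x + y) = adj L A x + adj L A y"
    by (rule adj_unique[OF L]) (simp_all add: P closed_csubspaceD[OF L] cinner_add_right)
  show "adj L A (c *\<^sub>C x) = c *\<^sub>C adj L A x"
    by (rule adj_unique[OF L]) (simp_all add: P closed_csubspaceD[OF L] cinner_scaleC_right)
  let ?a = "adj L A x"
  have "(norm ?a)\<^sup>2 = inner (A ?a) x"
    by (simp add: adj_adjoint_inner[OF L B] P power2_norm_eq_inner)
  also have "\<dots> \<le> norm ?a * norm x"
    using norm_cauchy_schwarz[of "A ?a" x] contraction_opD(2)[OF A P(1)[of x]]
    by (meson mult_right_mono norm_ge_zero order_trans)
  finally show "norm ?a \<le> norm x"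
    by (cases "norm ?a = 0") (simp_all add: power2_eq_square)
qed

lemma adj_adj:
  fixes A :: "'a :: chilbert_space \<Rightarrow> 'b :: chilbert_space"
  assumes L: "closed_csubspace L" and L': "closed_csubspace L'" and A: "bounded_op L L' A" and x: "x \<in> L"
  shows "adj L' (adj L A) x = A x"
proof (rule adj_unique[OF L'])
  show "A x \<in> L'" using bounded_opD[OF A] x by blast
  show "cinner (adj L A u) x = cinner u (A x)" for u
    using adj_props(2)[OF L A x] by (metis cinner_commute)
qed

section \<open>Square roots and defect operators\<close>

subsection \<open>The binomial series of the square root\<close>

text \<open>
  The Taylor coefficients of \<open>\<surd>(1 - t)\<close>. All but the first are at most \<open>0\<close>, and the partial sums
  are at least \<open>0\<close>; so the series of their absolute values converges, and the square root series
  of an operator converges even when its norm is \<open>1\<close>.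
\<close>

definition sqrt_coeff :: "nat \<Rightarrow> real" where
  "sqrt_coeff k = (- 1) ^ k * (1/2 gchoose k)"

lemma sqrt_coeff_0 [simp]: "sqrt_coeff 0 = 1"
  by (simp add: sqrt_coeff_def)

lemma sqrt_coeff_Suc_nonpos: "sqrt_coeff (Suc k) \<le> 0"
proof -
  have "sqrt_coeff (Suc k) = pochhammer (- 1/2) (Suc k) / fact (Suc k)"
    by (simp add: sqrt_coeff_def gbinomial_pochhammer del: fact_Suc flip: power_add)
  also have "\<dots> = - (pochhammer (1/2) k / (2 * fact (Suc k)))"
    by (simp add: pochhammer_rec del: fact_Suc)
  also have "\<dots> \<le> 0"
    using pochhammer_pos[of "1/2 :: real" k] by (simp del: fact_Suc)
  finally show ?thesis .
qed

lemma sum_sqrt_coeff_nonneg: "0 \<le> (\<Sum>k\<le>m. sqrt_coeff k)"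
proof -
  have "(\<Sum>k\<le>m. sqrt_coeff k) = (- 1) ^ m * (- (1/2) gchoose m)"
    using gbinomial_sum_lower_neg[of "1/2 :: real" m]
    by (simp add: sqrt_coeff_def mult.commute)
  also have "\<dots> = pochhammer (1/2) m / fact m"
    by (simp add: gbinomial_pochhammer flip: power_add)
  also have "\<dots> \<ge> 0"
    using pochhammer_pos[of "1/2 :: real" m] by simp
  finally show ?thesis .
qed

lemma sum_abs_sqrt_coeff_le: "(\<Sum>k\<le>m. \<bar>sqrt_coeff k\<bar>) \<le> 2"
proof -
  have "(\<Sum>k\<le>m. \<bar>sqrt_coeff k\<bar>) = 2 - (\<Sum>k\<le>m. sqrt_coeff k)"
    by (induction m) (simp_all add: abs_of_nonpos sqrt_coeff_Suc_nonpos)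
  then show ?thesis using sum_sqrt_coeff_nonneg[of m] by simp
qed

lemma summable_abs_sqrt_coeff: "summable (\<lambda>k. \<bar>sqrt_coeff k\<bar>)"
  by (rule bounded_imp_summable[OF _ sum_abs_sqrt_coeff_le]) simp

lemma suminf_abs_sqrt_coeff_le: "(\<Sum>k. \<bar>sqrt_coeff k\<bar>) \<le> 2"
proof (rule LIMSEQ_le_const2)
  show "(\<lambda>m. \<Sum>k\<le>m. \<bar>sqrt_coeff k\<bar>) \<longlonglongrightarrow> (\<Sum>k. \<bar>sqrt_coeff k\<bar>)"
    by (rule summable_LIMSEQ'[OF summable_abs_sqrt_coeff])
qed (use sum_abs_sqrt_coeff_le in blast)

text \<open>
  This is \<open>\<surd>(1 - t) \<surd>(1 - t) = 1 - t\<close> read off at \<open>t\<^sup>i\<close>, an instance of Vandermonde's identity.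
\<close>

lemma sqrt_coeff_convolution:
  "(\<Sum>j\<le>i. sqrt_coeff j * sqrt_coeff (i - j)) = (- 1) ^ i * real (1 choose i)"
proof -
  have "(\<Sum>j\<le>i. sqrt_coeff j * sqrt_coeff (i - j))
      = (\<Sum>j\<le>i. (- 1) ^ i * ((1/2 gchoose j) * (1/2 gchoose (i - j))))"
    by (intro sum.cong refl) (simp add: sqrt_coeff_def flip: power_add)
  also have "\<dots> = (- 1) ^ i * (1 gchoose i)"
    using gbinomial_Vandermonde[of "1/2 :: real" "1/2" i]
    by (simp add: atMost_atLeast0 flip: sum_distrib_left)
  finally show ?thesis using binomial_gbinomial[of 1 i, where 'a = real] by simp
qed

definition sqrt_series :: "('a \<Rightarrow> 'a) \<Rightarrow> 'a \<Rightarrow> 'a :: complex_inner" where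
  "sqrt_series A x = (\<Sum>k. sqrt_coeff k *\<^sub>R (A ^^ k) x)"

lemma contraction_op_funpow: "contraction_op L L A \<Longrightarrow> contraction_op L L (A ^^ k)"
proof (induction k)
  case 0
  then show ?case by (auto intro!: contraction_opI)
next
  case (Suc k)
  then show ?case using contraction_op_comp[of L L "A ^^ k" L A] by (simp add: o_def)
qed

lemma norm_sqrt_term_le:
  assumes "contraction_op L L A" "x \<in> L"
  shows "norm (sqrt_coeff k *\<^sub>R (A ^^ k) x) \<le> \<bar>sqrt_coeff k\<bar> * norm x"
  using contraction_opD(2)[OF contraction_op_funpow[OF assms(1)] assms(2)]
  by (simp add: mult_left_mono)

lemma sqrt_series_sums:
  fixes L :: "'a :: chilbert_space set"
  assumes "contraction_op L L A" "x \<in> L"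
  shows "summable (\<lambda>k. norm (sqrt_coeff k *\<^sub>R (A ^^ k) x))"
    "(\<lambda>k. sqrt_coeff k *\<^sub>R (A ^^ k) x) sums sqrt_series A x"
proof -
  show s: "summable (\<lambda>k. norm (sqrt_coeff k *\<^sub>R (A ^^ k) x))"
    by (rule summable_comparison_test'[of "\<lambda>k. \<bar>sqrt_coeff k\<bar> * norm x" 0])
       (use norm_sqrt_term_le[OF assms] in \<open>auto intro: summable_mult2 summable_abs_sqrt_coeff\<close>)
  show "(\<lambda>k. sqrt_coeff k *\<^sub>R (A ^^ k) x) sums sqrt_series A x"
    unfolding sqrt_series_def by (rule summable_sums[OF summable_norm_cancel[OF s]])
qed

text \<open>
  From \<open>T A = A' T\<close> follows \<open>T A\<^sup>k = A'\<^sup>k T\<close>, and \<open>T\<close> passes through the series. With \<open>T\<close> an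
  operator that commutes with \<open>A\<close> this gives commutation with the square root, and with \<open>T\<close> a
  contraction \<open>G\<close>, \<open>A = G\<^sup>* G\<close> and \<open>A' = G G\<^sup>*\<close> it gives the intertwining of the two defect
  operators.
\<close>

lemma sqrt_series_intertwines:
  fixes L :: "'a :: chilbert_space set" and L' :: "'b :: chilbert_space set"
  assumes L: "closed_csubspace L" and A: "contraction_op L L A" and A': "contraction_op L' L' A'"
    and T: "bounded_op L L' T" and eq: "\<And>x. x \<in> L \<Longrightarrow> T (A x) = A' (T x)" and x: "x \<in> L"
  shows "T (sqrt_series A x) = sqrt_series A' (T x)"
proof -
  have in_L: "(A ^^ k) x \<in> L" for k
    using bounded_opD(1)[OF contraction_opD(1)[OF contraction_op_funpow[OF A]] x] .
  have pow: "T ((A ^^ k) x) = (A' ^^ k) (T x)" for k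
    by (induction k) (simp_all add: eq in_L)
  have "(\<lambda>k. T (sqrt_coeff k *\<^sub>R (A ^^ k) x)) sums T (sqrt_series A x)"
    by (rule bounded_op_sums[OF L T _ sqrt_series_sums(2)[OF A x]])
       (simp add: closed_csubspaceD[OF L] in_L)
  then have "(\<lambda>k. sqrt_coeff k *\<^sub>R (A' ^^ k) (T x)) sums T (sqrt_series A x)"
    by (simp add: bounded_opD(4)[OF T] in_L pow)
  then show ?thesis
    using sqrt_series_sums(2)[OF A' bounded_opD(1)[OF T x]] by (rule sums_unique2)
qed

lemma bounded_op_sqrt_series:
  fixes L :: "'a :: chilbert_space set"
  assumes L: "closed_csubspace L" and A: "contraction_op L L A"
  shows "bounded_op L L (sqrt_series A)"
proof -
  note pow = contraction_opD(1)[OF contraction_op_funpow[OF A]]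
  note LD = closed_csubspaceD[OF L]
  note sums = sqrt_series_sums[OF A]
  have id: "bounded_op L L (\<lambda>x. x)" using pow[of 0] by (simp add: id_def)
  have in_L: "sqrt_coeff k *\<^sub>R (A ^^ k) x \<in> L" if "x \<in> L" for x k
    by (rule LD(7)[OF bounded_opD(1)[OF pow that]])
  have "sqrt_series A x \<in> L" if "x \<in> L" for x
    by (rule bounded_op_sums(1)[OF L id in_L[OF that] sums(2)[OF that]])
  moreover have "sqrt_series A (x + y) = sqrt_series A x + sqrt_series A y"
    if "x \<in> L" "y \<in> L" for x y
  proof (rule sums_unique2)
    show "(\<lambda>k. sqrt_coeff k *\<^sub>R (A ^^ k) (x + y)) sums sqrt_series A (x + y)"
      by (rule sums(2)[OF LD(3)[OF that]])
    show "(\<lambda>k. sqrt_coeff k *\<^sub>R (A ^^ k) (x + y)) sums (sqrt_series A x + sqrt_series A y)"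
      using sums_add[OF sums(2)[OF that(1)] sums(2)[OF that(2)]]
      by (simp add: bounded_opD(2)[OF pow that] scaleR_add_right)
  qed
  moreover have "sqrt_series A (c *\<^sub>C x) = c *\<^sub>C sqrt_series A x" if "x \<in> L" for x c
  proof -
    have "(\<lambda>k. c *\<^sub>C sqrt_coeff k *\<^sub>R (A ^^ k) x) sums (c *\<^sub>C sqrt_series A x)"
      by (rule bounded_linear.sums[OF bounded_linear_scaleC sums(2)[OF that]])
    moreover have "c *\<^sub>C sqrt_coeff k *\<^sub>R (A ^^ k) x = sqrt_coeff k *\<^sub>R (A ^^ k) (c *\<^sub>C x)" for k
      by (simp add: bounded_opD(3)[OF pow that] scaleR_scaleC scaleC_scaleC mult.commute)
    ultimately have "(\<lambda>k. sqrt_coeff k *\<^sub>R (A ^^ k) (c *\<^sub>C x)) sums (c *\<^sub>C sqrt_series A x)"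
      by simp
    then show ?thesis
      by (rule sums_unique2[OF sums(2)[OF LD(4)[OF that]]])
  qed
  moreover have "norm (sqrt_series A x) \<le> 2 * norm x" if "x \<in> L" for x
  proof -
    have "norm (sqrt_series A x) \<le> (\<Sum>k. norm (sqrt_coeff k *\<^sub>R (A ^^ k) x))"
      unfolding sqrt_series_def by (rule summable_norm[OF sums(1)[OF that]])
    also have "\<dots> \<le> (\<Sum>k. \<bar>sqrt_coeff k\<bar> * norm x)"
      by (intro suminf_le norm_sqrt_term_le[OF A that] sums(1)[OF that]
          summable_mult2 summable_abs_sqrt_coeff)
    also have "\<dots> = (\<Sum>k. \<bar>sqrt_coeff k\<bar>) * norm x"
      by (rule suminf_mult2[symmetric, OF summable_abs_sqrt_coeff])
    also have "\<dots> \<le> 2 * norm x"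
      by (intro mult_right_mono suminf_abs_sqrt_coeff_le norm_ge_zero)
    finally show ?thesis .
  qed
  ultimately show ?thesis unfolding bounded_op_def by (intro conjI ballI allI exI[of _ 2])
qed

lemma sqrt_series_symmetric:
  fixes L :: "'a :: chilbert_space set"
  assumes A: "contraction_op L L A" and sym: "\<And>x y. x \<in> L \<Longrightarrow> y \<in> L \<Longrightarrow> inner (A x) y = inner x (A y)"
    and xy: "x \<in> L" "y \<in> L"
  shows "inner (sqrt_series A x) y = inner x (sqrt_series A y)"
proof -
  have in_L: "(A ^^ k) w \<in> L" if "w \<in> L" for w k
    using bounded_opD(1)[OF contraction_opD(1)[OF contraction_op_funpow[OF A]] that] .
  have pow: "inner ((A ^^ k) x) w = inner x ((A ^^ k) w)" if "w \<in> L" for w k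
    using that
  proof (induction k arbitrary: w)
    case (Suc k)
    then have "A w \<in> L" using in_L[of w 1] by simp
    then have "inner (A ((A ^^ k) x)) w = inner x ((A ^^ k) (A w))"
      using Suc sym[OF in_L[OF xy(1)]] by simp
    then show ?case by (simp add: funpow_swap1)
  qed simp
  have "(\<lambda>k. inner (sqrt_coeff k *\<^sub>R (A ^^ k) x) y) sums inner (sqrt_series A x) y"
    by (rule bounded_linear.sums[OF bounded_linear_inner_left sqrt_series_sums(2)[OF A xy(1)]])
  moreover have "(\<lambda>k. inner x (sqrt_coeff k *\<^sub>R (A ^^ k) y)) sums inner x (sqrt_series A y)"
    by (rule bounded_linear.sums[OF bounded_linear_inner_right sqrt_series_sums(2)[OF A xy(2)]])
  ultimately show ?thesis unfolding inner_scaleR_left inner_scaleR_right pow[OF xy(2)]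
    by (rule sums_unique2)
qed

text \<open>
  The leading term contributes \<open>\<parallel>x\<parallel>\<^sup>2\<close>; each later coefficient is at most \<open>0\<close> and multiplies a
  number that is at most \<open>\<parallel>x\<parallel>\<^sup>2\<close>. So the partial sums are at least \<open>\<parallel>x\<parallel>\<^sup>2\<close> times a partial sum
  of the coefficients.
\<close>

lemma sqrt_series_nonneg:
  fixes L :: "'a :: chilbert_space set"
  assumes A: "contraction_op L L A" and x: "x \<in> L"
  shows "0 \<le> inner (sqrt_series A x) x"
proof (rule LIMSEQ_le_const)
  let ?t = "\<lambda>k. inner (sqrt_coeff k *\<^sub>R (A ^^ k) x) x"
  have "?t sums inner (sqrt_series A x) x"
    by (rule bounded_linear.sums[OF bounded_linear_inner_left sqrt_series_sums(2)[OF A x]])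
  then show "(\<lambda>m. \<Sum>k\<le>m. ?t k) \<longlonglongrightarrow> inner (sqrt_series A x) x"
    by (simp add: sums_def_le)
  have "0 \<le> (\<Sum>k\<le>m. ?t k)" for m
  proof -
    have "sqrt_coeff k * (norm x)\<^sup>2 \<le> ?t k" for k
    proof (cases k)
      case (Suc i)
      have "inner ((A ^^ k) x) x \<le> norm ((A ^^ k) x) * norm x" by (rule norm_cauchy_schwarz)
      also have "\<dots> \<le> norm x * norm x"
        by (intro mult_right_mono contraction_opD(2)[OF contraction_op_funpow[OF A] x]) auto
      finally show ?thesis
        using sqrt_coeff_Suc_nonpos[of i] by (simp add: Suc power2_eq_square mult_left_mono_neg)
    qed (simp add: power2_norm_eq_inner)
    then have "(\<Sum>k\<le>m. sqrt_coeff k * (norm x)\<^sup>2) \<le> (\<Sum>k\<le>m. ?t k)" by (rule sum_mono)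
    moreover have "0 \<le> (\<Sum>k\<le>m. sqrt_coeff k * (norm x)\<^sup>2)"
      using sum_sqrt_coeff_nonneg[of m] by (simp flip: sum_distrib_right)
    ultimately show ?thesis by linarith
  qed
  then show "\<exists>N. \<forall>m\<ge>N. 0 \<le> (\<Sum>k\<le>m. ?t k)" by blast
qed

text \<open>
  The Cauchy product of the series with itself, written as an absolutely convergent double
  series and regrouped along the diagonals \<open>j + k = i\<close>.
\<close>

lemma sqrt_series_square:
  fixes L :: "'a :: chilbert_space set"
  assumes L: "closed_csubspace L" and A: "contraction_op L L A" and x: "x \<in> L"
  shows "sqrt_series A (sqrt_series A x) = x - A x"
proof -
  let ?c = sqrt_coeff and ?S = "sqrt_series A"
  define F where "F = (\<lambda>(j, k). (?c j * ?c k) *\<^sub>R (A ^^ (j + k)) x)"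
  note pow = contraction_op_funpow[OF A]
  have in_L: "(A ^^ k) x \<in> L" for k
    using bounded_opD(1)[OF contraction_opD(1)[OF pow] x] .
  have to_infsum: "?S w = (\<Sum>\<^sub>\<infinity>k. ?c k *\<^sub>R (A ^^ k) w)" if "w \<in> L" for w
    using infsumI[OF norm_summable_imp_has_sum[OF sqrt_series_sums[OF A that]]] by simp
  have abs_c: "(\<lambda>k. \<bar>?c k\<bar>) summable_on UNIV"
    by (rule norm_summable_imp_summable_on) (simp add: summable_abs_sqrt_coeff)
  have "(\<lambda>p. norm (case p of (j, k) \<Rightarrow> ?c j * ?c k * norm x)) summable_on UNIV \<times> UNIV"
    unfolding Infinite_Sum.abs_summable_on_Sigma_iff using abs_c
    by (auto simp: abs_mult infsum_cmult_left' infsum_cmult_right'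
        intro!: summable_on_cmult_right summable_on_cmult_left)
  then have "(\<lambda>p. norm (F p)) summable_on UNIV \<times> UNIV"
  proof (rule Infinite_Sum.abs_summable_on_comparison_test)
    fix p :: "nat \<times> nat"
    show "norm (F p) \<le> norm (case p of (j, k) \<Rightarrow> ?c j * ?c k * norm x)"
      using contraction_opD(2)[OF pow x]
      by (auto simp: F_def abs_mult split: prod.splits intro!: mult_left_mono)
  qed
  then have F: "F summable_on UNIV \<times> UNIV" by (rule abs_summable_summable)
  let ?g = "\<lambda>(i, j). (j, i - j) :: nat \<times> nat"
  have bij: "bij_betw ?g (SIGMA i:UNIV. {..i}) (UNIV \<times> UNIV)"
    by (rule bij_betwI[of _ _ _ "\<lambda>(j, k). (j + k, j)"]) auto
  have F': "(\<lambda>p. F (?g p)) summable_on (SIGMA i:UNIV. {..i})"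
    using F summable_on_reindex_bij_betw[OF bij, of F] by simp
  have "?S (?S x) = (\<Sum>\<^sub>\<infinity>j. ?c j *\<^sub>R (A ^^ j) (?S x))"
    by (rule to_infsum[OF bounded_opD(1)[OF bounded_op_sqrt_series[OF L A] x]])
  also have "\<dots> = (\<Sum>\<^sub>\<infinity>j. \<Sum>\<^sub>\<infinity>k. F (j, k))"
  proof (rule infsum_cong)
    fix j
    have "(A ^^ j) (?S x) = ?S ((A ^^ j) x)"
      by (rule sqrt_series_intertwines[OF L A A contraction_opD(1)[OF pow] _ x])
         (simp add: funpow_swap1)
    also have "\<dots> = (\<Sum>\<^sub>\<infinity>k. ?c k *\<^sub>R (A ^^ (j + k)) x)"
      by (simp add: to_infsum[OF in_L] add.commute[of j] funpow_add)
    finally show "?c j *\<^sub>R (A ^^ j) (?S x) = (\<Sum>\<^sub>\<infinity>k. F (j, k))"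
      by (simp add: F_def infsum_scaleR_right flip: scaleR_scaleR)
  qed
  also have "\<dots> = infsum F (UNIV \<times> UNIV)"
    using infsum_Sigma'_banach[of "\<lambda>j k. F (j, k)" UNIV "\<lambda>_. UNIV"] F by simp
  also have "\<dots> = (\<Sum>\<^sub>\<infinity>p\<in>(SIGMA i:UNIV. {..i}). F (?g p))"
    by (rule infsum_reindex_bij_betw[OF bij, symmetric])
  also have "\<dots> = (\<Sum>\<^sub>\<infinity>i. \<Sum>\<^sub>\<infinity>j\<in>{..i}. F (j, i - j))"
    using infsum_Sigma'_banach[of "\<lambda>i j. F (j, i - j)" UNIV "\<lambda>i. {..i}"] F' by (simp add: case_prod_unfold)
  also have "\<dots> = (\<Sum>\<^sub>\<infinity>i. ((- 1) ^ i * real (1 choose i)) *\<^sub>R (A ^^ i) x)"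
    by (simp add: F_def sqrt_coeff_convolution flip: scaleR_sum_left)
  also have "\<dots> = (\<Sum>\<^sub>\<infinity>i\<in>{0, 1}. ((- 1) ^ i * real (1 choose i)) *\<^sub>R (A ^^ i) x)"
    by (rule infsum_cong_neutral) (auto simp: binomial_eq_0)
  also have "\<dots> = x - A x" by simp
  finally show ?thesis .
qed

subsection \<open>Uniqueness of the square root\<close>

text \<open>
  Polarisation: the imaginary part of the form at \<open>v + y\<close> isolates the imaginary part of the
  asserted identity for \<open>v\<close>, and \<open>v = \<i> x\<close> turns it into the real part.
\<close>

lemma symmetric_of_real_form:
  fixes L :: "'a :: complex_inner set"
  assumes L: "closed_csubspace L" and B: "bounded_op L L B"
    and real: "\<And>x. x \<in> L \<Longrightarrow> cinner (B x) x \<in> \<real>" and xy: "x \<in> L" "y \<in> L"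
  shows "inner (B x) y = inner x (B y)"
proof -
  have Im_eq: "Im (cinner (B v) y) = Im (cinner v (B y))" if v: "v \<in> L" for v
  proof -
    have "Im (cinner (B (v + y)) (v + y)) = 0" "Im (cinner (B v) v) = 0" "Im (cinner (B y) y) = 0"
      using real[of "v + y"] real[of v] real[of y] v xy closed_csubspaceD(3)[OF L]
      by (auto simp: complex_is_Real_iff)
    then have "Im (cinner (B v) y) + Im (cinner (B y) v) = 0"
      by (simp add: bounded_opD(2)[OF B v xy(2)] cinner_add_left cinner_add_right)
    then show ?thesis using cinner_commute[of "B y" v] by simp
  qed
  have "Im (cinner (B (\<i> *\<^sub>C x)) y) = Im (cinner (\<i> *\<^sub>C x) (B y))"
    by (rule Im_eq) (simp add: xy closed_csubspaceD[OF L])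
  then show ?thesis
    by (simp add: bounded_opD(3)[OF B xy(1)] cinner_scaleC_left Re_cinner)
qed

text \<open>
  The nonnegative form at \<open>y + t B y\<close> is a quadratic polynomial in \<open>t\<close> without constant term, so
  its linear coefficient \<open>2 \<parallel>B y\<parallel>\<^sup>2\<close> vanishes.
\<close>

lemma nonneg_form_zero_imp_zero:
  fixes L :: "'a :: complex_inner set"
  assumes L: "closed_csubspace L" and B: "bounded_op L L B"
    and sym: "\<And>x y. x \<in> L \<Longrightarrow> y \<in> L \<Longrightarrow> inner (B x) y = inner x (B y)"
    and nonneg: "\<And>x. x \<in> L \<Longrightarrow> 0 \<le> inner (B x) x"
    and y: "y \<in> L" "inner (B y) y = 0"
  shows "B y = 0"
proof -
  note LD = closed_csubspaceD[OF L]
  let ?w = "B y"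
  have w: "?w \<in> L" by (rule bounded_opD(1)[OF B y(1)])
  have "0 \<le> 2 * t * inner ?w ?w + t\<^sup>2 * inner (B ?w) ?w" for t
  proof -
    have tw: "t *\<^sub>R ?w \<in> L" by (rule LD(7)[OF w])
    have "0 \<le> inner (B (y + t *\<^sub>R ?w)) (y + t *\<^sub>R ?w)"
      by (rule nonneg[OF LD(3)[OF y(1) tw]])
    also have "\<dots> = 2 * t * inner ?w ?w + t\<^sup>2 * inner (B ?w) ?w"
      using sym[OF w y(1)] y(2)
      by (simp add: bounded_opD(2)[OF B y(1) tw] bounded_opD(4)[OF B w]
          inner_add_left inner_add_right power2_eq_square algebra_simps)
    finally show ?thesis .
  qed
  then have "inner ?w ?w = 0" by (rule quadratic_nonneg_imp_zero)
  then show ?thesis by simp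
qed

text \<open>
  A nonnegative square root \<open>B\<close> commutes with \<open>A = I - B\<^sup>2\<close>, hence with the series \<open>S\<close>. So for
  \<open>y = (B - S) x\<close> one has \<open>(B + S) y = (B\<^sup>2 - S\<^sup>2) x = 0\<close>; both forms are nonnegative, which
  forces \<open>B y = S y = 0\<close>, and then \<open>\<parallel>y\<parallel>\<^sup>2 = \<langle>x, (B - S) y\<rangle> = 0\<close>.
\<close>

lemma sqrt_unique:
  fixes L :: "'a :: chilbert_space set"
  assumes L: "closed_csubspace L" and A: "contraction_op L L A"
    and sym: "\<And>x y. x \<in> L \<Longrightarrow> y \<in> L \<Longrightarrow> inner (A x) y = inner x (A y)"
    and B: "bounded_op L L B"
    and B_pos: "\<And>x. x \<in> L \<Longrightarrow> cinner (B x) x \<in> \<real> \<and> 0 \<le> Re (cinner (B x) x)"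
    and B_sq: "\<And>x. x \<in> L \<Longrightarrow> B (B x) = x - A x" and x: "x \<in> L"
  shows "B x = sqrt_series A x"
proof -
  let ?S = "sqrt_series A"
  note LD = closed_csubspaceD[OF L]
  note S = bounded_op_sqrt_series[OF L A]
  have S_sym: "inner (?S u) v = inner u (?S v)" if "u \<in> L" "v \<in> L" for u v
    using that by (intro sqrt_series_symmetric[OF A sym])
  have B_sym: "inner (B u) v = inner u (B v)" if "u \<in> L" "v \<in> L" for u v
    using symmetric_of_real_form[OF L B _ that] B_pos by blast
  have B_nonneg: "0 \<le> inner (B v) v" if "v \<in> L" for v
    using B_pos[OF that] by (simp add: Re_cinner)
  have B_diff: "B (u - v) = B u - B v" and S_diff: "?S (u - v) = ?S u - ?S v"
    if "u \<in> L" "v \<in> L" for u v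
    using that by (rule bounded_op_diff[OF L B], rule bounded_op_diff[OF L S])
  note in_L = bounded_opD(1)[OF B] bounded_opD(1)[OF S]
    bounded_opD(1)[OF contraction_opD(1)[OF A]] LD(6)
  have "B (A v) = A (B v)" if v: "v \<in> L" for v
  proof -
    have "A u = u - B (B u)" if "u \<in> L" for u using B_sq[OF that] by simp
    then show ?thesis using v by (simp add: in_L B_diff)
  qed
  then have comm: "B (?S v) = ?S (B v)" if "v \<in> L" for v
    using sqrt_series_intertwines[OF L A A B _ that] by blast
  define y where "y = B x - ?S x"
  have y: "y \<in> L" unfolding y_def using x by (intro in_L)
  have "B y + ?S y = 0"
    using x by (simp add: y_def B_diff S_diff in_L comm B_sq sqrt_series_square[OF L A])
  then have "inner (B y) y + inner (?S y) y = 0"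
    by (simp flip: inner_add_left)
  then have "inner (B y) y = 0" "inner (?S y) y = 0"
    using B_nonneg[OF y] sqrt_series_nonneg[OF A y] by linarith+
  then have "B y = 0" "?S y = 0"
    using nonneg_form_zero_imp_zero[OF L B B_sym B_nonneg y]
      nonneg_form_zero_imp_zero[OF L S S_sym sqrt_series_nonneg[OF A] y] by blast+
  then have "inner y y = 0"
    using B_sym[OF x y] S_sym[OF x y] unfolding y_def by (simp add: inner_diff_left)
  then show ?thesis by (simp add: y_def)
qed

lemma sqrt_op_eq_series:
  fixes L :: "'a :: chilbert_space set"
  assumes L: "closed_csubspace L" and A: "contraction_op L L A"
    and sym: "\<And>x y. x \<in> L \<Longrightarrow> y \<in> L \<Longrightarrow> inner (A x) y = inner x (A y)"
  shows "sqrt_op L (\<lambda>x. x - A x) = (\<lambda>x. if x \<in> L then sqrt_series A x else 0)"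
    (is "_ = ?S")
  unfolding sqrt_op_def
proof (rule the_equality)
  note S = bounded_op_sqrt_series[OF L A]
  have "cinner (sqrt_series A x) x \<in> \<real>" if x: "x \<in> L" for x
  proof -
    let ?b = "sqrt_series A x" and ?ix = "\<i> *\<^sub>C x"
    have ix: "?ix \<in> L" by (rule closed_csubspaceD(4)[OF L x])
    have "inner ?b ?ix = inner x (\<i> *\<^sub>C ?b)"
      using sqrt_series_symmetric[OF A sym x ix] by (simp add: bounded_opD(3)[OF S x])
    moreover have "inner (u :: 'a) (\<i> *\<^sub>C v) = Im (cinner u v)" for u v
      by (simp add: cinner_scaleC_right flip: Re_cinner)
    moreover have "Im (cinner x ?b) = - Im (cinner ?b x)"
      using cinner_commute[of x ?b] by simp
    ultimately show ?thesis by (simp add: complex_is_Real_iff)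
  qed
  then have "cinner (?S x) x \<in> \<real> \<and> 0 \<le> Re (cinner (?S x) x)" if "x \<in> L" for x
    using that sqrt_series_nonneg[OF A that] by (simp add: Re_cinner)
  moreover have "bounded_op L L ?S"
    using S closed_csubspaceD(3,4)[OF L] unfolding bounded_op_def by simp
  moreover have "?S (?S x) = x - A x" if "x \<in> L" for x
    using that sqrt_series_square[OF L A that] bounded_opD(1)[OF S that] by simp
  ultimately show "bounded_op L L ?S \<and>
      (\<forall>x\<in>L. cinner (?S x) x \<in> \<real> \<and> 0 \<le> Re (cinner (?S x) x)) \<and>
      (\<forall>x\<in>L. ?S (?S x) = x - A x) \<and> (\<forall>x. x \<notin> L \<longrightarrow> ?S x = 0)"
    by (intro conjI ballI allI impI) auto
next
  fix B assume B: "bounded_op L L B \<and> (\<forall>x\<in>L. cinner (B x) x \<in> \<real> \<and> 0 \<le> Re (cinner (B x) x)) \<and>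
     (\<forall>x\<in>L. B (B x) = x - A x) \<and> (\<forall>x. x \<notin> L \<longrightarrow> B x = 0)"
  show "B = ?S"
  proof
    fix x
    have "B x = sqrt_series A x" if "x \<in> L"
      by (rule sqrt_unique[OF L A sym _ _ _ that]) (use B in blast)+
    then show "B x = ?S x" using B by simp
  qed
qed

subsection \<open>Defect operators\<close>

locale contraction_between =
  fixes L :: "'a :: chilbert_space set" and L' :: "'b :: chilbert_space set" and G :: "'a \<Rightarrow> 'b"
  assumes L: "closed_csubspace L" and L': "closed_csubspace L'" and G: "contraction_op L L' G"
begin

lemmas G_op = contraction_opD(1)[OF G]
lemmas adj_op = contraction_opD(1)[OF contraction_op_adj[OF L G]]

lemma adjoint: "contraction_between L' L (adj L G)"
  by (intro contraction_between.intro L L' contraction_op_adj[OF L G])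

lemma contraction_op_adj_comp: "contraction_op L L (\<lambda>x. adj L G (G x))"
  using contraction_op_comp[OF G contraction_op_adj[OF L G]] by (simp add: o_def)

lemma adj_comp_symmetric:
  assumes "x \<in> L" "y \<in> L"
  shows "inner (adj L G (G x)) y = inner x (adj L G (G y))"
proof -
  have "inner (adj L G (G x)) y = inner (G y) (G x)"
    unfolding adj_adjoint_inner[OF L G_op assms(2)] by (rule inner_commute)
  also have "\<dots> = inner x (adj L G (G y))"
    unfolding adj_adjoint_inner[OF L G_op assms(1), symmetric] by (rule inner_commute)
  finally show ?thesis .
qed

lemma comp_adj_symmetric: "inner (G (adj L G x)) y = inner x (G (adj L G y))"
  using adj_adjoint_inner[OF L G_op adj_props(1)[OF L G_op]] by (metis inner_commute)

lemma defect_op_eq_series: "x \<in> L \<Longrightarrow> defect_op L G x = sqrt_series (\<lambda>x. adj L G (G x)) x"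
  unfolding defect_op_def
  by (simp add: sqrt_op_eq_series[OF L contraction_op_adj_comp adj_comp_symmetric])

lemma bounded_op_defect_op: "bounded_op L L (defect_op L G)"
  using bounded_op_sqrt_series[OF L contraction_op_adj_comp] closed_csubspaceD[OF L]
  unfolding bounded_op_def by (simp add: defect_op_eq_series)

lemma defect_op_symmetric:
  "x \<in> L \<Longrightarrow> y \<in> L \<Longrightarrow> inner (defect_op L G x) y = inner x (defect_op L G y)"
  by (simp add: defect_op_eq_series sqrt_series_symmetric[OF contraction_op_adj_comp adj_comp_symmetric])

lemma defect_op_norm: "x \<in> L \<Longrightarrow> (norm (defect_op L G x))\<^sup>2 = (norm x)\<^sup>2 - (norm (G x))\<^sup>2"
proof -
  assume x: "x \<in> L"
  let ?D = "defect_op L G"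
  have Dx: "?D x \<in> L" by (rule bounded_opD(1)[OF bounded_op_defect_op x])
  have "(norm (?D x))\<^sup>2 = inner x (?D (?D x))"
    by (simp add: power2_norm_eq_inner defect_op_symmetric[OF x Dx])
  also have "?D (?D x) = x - adj L G (G x)"
    using sqrt_series_square[OF L contraction_op_adj_comp x] Dx x by (simp add: defect_op_eq_series)
  finally show ?thesis
    by (simp add: inner_diff_right power2_norm_eq_inner flip: adj_adjoint_inner[OF L G_op x])
qed

lemma defect_space_seq:
  "x \<in> defect_space L G \<Longrightarrow> \<exists>v. (\<forall>i. v i \<in> L) \<and> (\<lambda>i. defect_op L G (v i)) \<longlonglongrightarrow> x"
proof -
  assume "x \<in> defect_space L G"
  then have "\<exists>f. (\<forall>i. f i \<in> defect_op L G ` L) \<and> f \<longlonglongrightarrow> x"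
    unfolding defect_space_def closure_sequential .
  then obtain f where f: "\<And>i. f i \<in> defect_op L G ` L" "f \<longlonglongrightarrow> x" by metis
  have "\<forall>i. \<exists>v. v \<in> L \<and> f i = defect_op L G v" using f(1) by (simp add: image_iff Bex_def)
  then obtain v where v: "\<forall>i. v i \<in> L \<and> f i = defect_op L G (v i)" by (rule choice[THEN exE])
  moreover have "f = (\<lambda>i. defect_op L G (v i))" using v by auto
  ultimately show ?thesis using f(2) by (intro exI[of _ v]) simp
qed

lemma defect_spaceI:
  assumes v: "\<And>i. v i \<in> L" and lim: "(\<lambda>i. defect_op L G (v i)) \<longlonglongrightarrow> x"
  shows "x \<in> defect_space L G"
  unfolding defect_space_def closure_sequential
  by (intro exI[of _ "\<lambda>i. defect_op L G (v i)"] conjI allI imageI v lim)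

lemma closed_csubspace_defect_space: "closed_csubspace (defect_space L G)"
  unfolding closed_csubspace_def
proof (intro conjI ballI allI)
  note D = bounded_opD[OF bounded_op_defect_op]
  note LD = closed_csubspaceD[OF L]
  show "closed (defect_space L G)" by (simp add: defect_space_def)
  show "0 \<in> defect_space L G"
    by (rule defect_spaceI[of "\<lambda>_. 0"])
       (simp_all add: LD(2) bounded_op_zero[OF L bounded_op_defect_op])
  fix x assume "x \<in> defect_space L G"
  from defect_space_seq[OF this]
  obtain u where u: "\<And>i. u i \<in> L" "(\<lambda>i. defect_op L G (u i)) \<longlonglongrightarrow> x" by metis
  show "x + y \<in> defect_space L G" if y: "y \<in> defect_space L G" for y
  proof -
    from defect_space_seq[OF y]
    obtain v where v: "\<And>i. v i \<in> L" "(\<lambda>i. defect_op L G (v i)) \<longlonglongrightarrow> y" by metis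
    show ?thesis
      using tendsto_add[OF u(2) v(2)]
      by (intro defect_spaceI[of "\<lambda>i. u i + v i"] LD(3) u(1) v(1)) (simp add: D(2) u(1) v(1))
  qed
  show "c *\<^sub>C x \<in> defect_space L G" for c
    using bounded_linear.tendsto[OF bounded_linear_scaleC u(2), of c]
    by (intro defect_spaceI[of "\<lambda>i. c *\<^sub>C u i"] LD(4) u(1)) (simp add: D(3) u(1))
qed

lemma defect_space_subset: "defect_space L G \<subseteq> L"
  unfolding defect_space_def
  by (rule closure_minimal) (auto simp: bounded_opD(1)[OF bounded_op_defect_op] closed_csubspaceD[OF L])

lemma defect_op_in_defect_space: "x \<in> L \<Longrightarrow> defect_op L G x \<in> defect_space L G"
  unfolding defect_space_def by (intro subsetD[OF closure_subset] imageI)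

lemma defect_op_intertwines: "x \<in> L \<Longrightarrow> G (defect_op L G x) = defect_op L' (adj L G) (G x)"
proof -
  assume x: "x \<in> L"
  note adj = contraction_op_adj[OF L G]
  have A': "contraction_op L' L' (\<lambda>y. G (adj L G y))"
    using contraction_op_comp[OF adj G] by (simp add: o_def)
  have "defect_op L' (adj L G) y = sqrt_series (\<lambda>y. G (adj L G y)) y" if y: "y \<in> L'" for y
  proof -
    have eq: "adj L' (adj L G) (adj L G v) = G (adj L G v)" for v
      by (rule adj_adj[OF L L' G_op adj_props(1)[OF L G_op]])
    show ?thesis
      unfolding defect_op_def eq
      by (simp add: sqrt_op_eq_series[OF L' A' comp_adj_symmetric] y)
  qed
  then show ?thesis
    using sqrt_series_intertwines[OF L contraction_op_adj_comp A' G_op _ x]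
      x bounded_opD(1)[OF G_op x]
    by (simp add: defect_op_eq_series)
qed

text \<open>
  The adjoint of the preceding relation. Testing against vectors of \<open>L\<close> avoids comparing the
  defect operator of \<open>G\<close> with that of its double adjoint, which agrees with \<open>G\<close> only on \<open>L\<close>.
\<close>

lemma adj_defect_op:
  assumes y: "y \<in> L'"
  shows "adj L G (defect_op L' (adj L G) y) = defect_op L G (adj L G y)"
proof -
  let ?G' = "adj L G" and ?D = "defect_op L G" and ?D' = "defect_op L' (adj L G)"
  have G'_in: "?G' v \<in> L" for v by (rule adj_props(1)[OF L G_op])
  interpret A: contraction_between L' L ?G' by (rule adjoint)
  have D_in: "?D v \<in> L" if "v \<in> L" for v
    using that by (rule bounded_opD(1)[OF bounded_op_defect_op])
  have "inner u (?G' (?D' y)) = inner u (?D (?G' y))" if u: "u \<in> L" for u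
  proof -
    have "inner u (?G' (?D' y)) = inner (G u) (?D' y)"
      by (rule adj_adjoint_inner[OF L G_op u, symmetric])
    also have "\<dots> = inner (?D' (G u)) y"
      by (rule A.defect_op_symmetric[symmetric, OF bounded_opD(1)[OF G_op u] y])
    also have "\<dots> = inner (G (?D u)) y" by (simp add: defect_op_intertwines[OF u])
    also have "\<dots> = inner (?D u) (?G' y)" by (rule adj_adjoint_inner[OF L G_op D_in[OF u]])
    also have "\<dots> = inner u (?D (?G' y))" by (rule defect_op_symmetric[OF u G'_in])
    finally show ?thesis .
  qed
  from this[OF closed_csubspaceD(6)[OF L G'_in[of "?D' y"] D_in[OF G'_in[of y]]]]
  have "inner (?G' (?D' y) - ?D (?G' y)) (?G' (?D' y) - ?D (?G' y)) = 0"
    by (simp add: inner_diff_right)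
  then show ?thesis by simp
qed

text \<open>
  On the range of the defect operator of the adjoint this is the relation above; continuity
  extends it to the closure.
\<close>

lemma adj_in_defect_space:
  assumes y: "y \<in> defect_space L' (adj L G)"
  shows "adj L G y \<in> defect_space L G"
proof -
  let ?G' = "adj L G" and ?D' = "defect_op L' (adj L G)"
  interpret A: contraction_between L' L ?G' by (rule adjoint)
  have yL': "y \<in> L'" using y by (rule subsetD[OF A.defect_space_subset])
  from A.defect_space_seq[OF y]
  obtain v where v: "\<And>i. v i \<in> L'" "(\<lambda>i. ?D' (v i)) \<longlonglongrightarrow> y" by metis
  have D'v: "?D' (v i) \<in> L'" for i
    by (rule bounded_opD(1)[OF A.bounded_op_defect_op v(1)])
  have "(\<lambda>i. ?G' (?D' (v i))) \<longlonglongrightarrow> ?G' y"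
  proof (rule LIM_zero_cancel, rule Lim_null_comparison)
    have "norm (?G' (?D' (v i)) - ?G' y) \<le> norm (?D' (v i) - y)" for i
      using contraction_opD(2)[OF A.G closed_csubspaceD(6)[OF L' D'v yL'], of i]
      by (simp add: bounded_op_diff[OF L' adj_op D'v yL'])
    then show "\<forall>\<^sub>F i in sequentially. norm (?G' (?D' (v i)) - ?G' y) \<le> norm (?D' (v i) - y)"
      by simp
    show "(\<lambda>i. norm (?D' (v i) - y)) \<longlonglongrightarrow> 0" using v(2) by (simp add: tendsto_norm_zero LIM_zero)
  qed
  then show ?thesis
    by (intro defect_spaceI[of "\<lambda>i. ?G' (v i)"])
       (simp_all add: adj_props(1)[OF L G_op] flip: adj_defect_op[OF v(1)])
qed

text \<open>
  The cross terms cancel because \<open>G D = D' G\<close>, where \<open>D\<close> and \<open>D'\<close> are the defect operators of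
  \<open>G\<close> and of its adjoint.
\<close>

lemma rotation_isometric:
  assumes x: "x \<in> L" and y: "y \<in> L'"
  shows "(norm (G x + defect_op L' (adj L G) y))\<^sup>2 + (norm (defect_op L G x - adj L G y))\<^sup>2
    = (norm x)\<^sup>2 + (norm y)\<^sup>2"
proof -
  let ?G' = "adj L G" and ?D = "defect_op L G" and ?D' = "defect_op L' (adj L G)"
  interpret A: contraction_between L' L ?G' by (rule adjoint)
  have "inner (G x) (?D' y) = inner (?D' (G x)) y"
    by (rule A.defect_op_symmetric[symmetric, OF bounded_opD(1)[OF G_op x] y])
  also have "\<dots> = inner (?D x) (?G' y)"
    unfolding defect_op_intertwines[OF x, symmetric]
    by (rule adj_adjoint_inner[OF L G_op bounded_opD(1)[OF bounded_op_defect_op x]])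
  finally have cross: "inner (G x) (?D' y) = inner (?D x) (?G' y)" .
  have plus: "(norm (a + b))\<^sup>2 = (norm a)\<^sup>2 + 2 * inner a b + (norm b)\<^sup>2" for a b :: 'b
    by (simp add: power2_norm_eq_inner inner_add inner_commute)
  have minus: "(norm (a - b))\<^sup>2 = (norm a)\<^sup>2 - 2 * inner a b + (norm b)\<^sup>2" for a b :: 'a
    by (simp add: power2_norm_eq_inner inner_diff inner_commute)
  show ?thesis
    unfolding plus minus cross using defect_op_norm[OF x] A.defect_op_norm[OF y] by simp
qed

end


subsection \<open>Invertibility of perturbations of the identity\<close>

lemma invertible_op_inv_into:
  assumes "invertible_op L A"
  shows "y \<in> L \<Longrightarrow> inv_into L A y \<in> L" "y \<in> L \<Longrightarrow> A (inv_into L A y) = y"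
    "x \<in> L \<Longrightarrow> inv_into L A (A x) = x"
proof -
  obtain B where B: "\<And>x. x \<in> L \<Longrightarrow> B x \<in> L" "\<And>x. x \<in> L \<Longrightarrow> A (B x) = x" "\<And>x. x \<in> L \<Longrightarrow> B (A x) = x"
    using assms unfolding invertible_op_def bounded_op_def by metis
  have "y \<in> A ` L" if "y \<in> L" for y
    by (rule image_eqI[where x = "B y"]) (simp_all add: B that)
  then show "y \<in> L \<Longrightarrow> inv_into L A y \<in> L" "y \<in> L \<Longrightarrow> A (inv_into L A y) = y"
    by (simp_all add: inv_into_into f_inv_into_f)
  have "inj_on A L" by (rule inj_on_inverseI[of L B]) (rule B(3))
  then show "x \<in> L \<Longrightarrow> inv_into L A (A x) = x" by (rule inv_into_f_f)
qed

text \<open>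
  For given \<open>y\<close> the map \<open>x \<mapsto> y + z C x\<close> is a strict contraction of the complete set \<open>L\<close>, so
  Banach's theorem solves \<open>x - z C x = y\<close>. The estimate \<open>(1 - |z|) \<parallel>x\<parallel> \<le> \<parallel>x - z C x\<parallel>\<close> makes the
  inverse single-valued and bounded.
\<close>

lemma invertible_op_id_minus:
  fixes L :: "'a :: chilbert_space set"
  assumes L: "closed_csubspace L" and C: "contraction_op L L C" and z: "cmod z < 1"
  shows "invertible_op L (\<lambda>x. x - z *\<^sub>C C x)"
proof -
  let ?A = "\<lambda>x. x - z *\<^sub>C C x"
  note LD = closed_csubspaceD[OF L]
  note CD = bounded_opD[OF contraction_opD(1)[OF C]]
  have zC: "norm (z *\<^sub>C C x) \<le> cmod z * norm x" if "x \<in> L" for x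
    using contraction_opD(2)[OF C that] by (simp add: norm_scaleC mult_left_mono)
  have A_in: "?A x \<in> L" if "x \<in> L" for x
    by (intro LD(6) LD(4) CD(1) that)
  have A_diff: "?A (x - y) = ?A x - ?A y" if "x \<in> L" "y \<in> L" for x y
    using bounded_op_diff[OF L contraction_opD(1)[OF C] that] by (simp add: scaleC_diff_right)
  have A_add: "?A (x + y) = ?A x + ?A y" if "x \<in> L" "y \<in> L" for x y
    using CD(2)[OF that] by (simp add: scaleC_add_right)
  have A_scale: "?A (c *\<^sub>C x) = c *\<^sub>C ?A x" if "x \<in> L" for x c
    using CD(3)[OF that] by (simp add: scaleC_diff_right scaleC_scaleC mult.commute)
  have below: "(1 - cmod z) * norm x \<le> norm (?A x)" if "x \<in> L" for x
    using zC[OF that] norm_triangle_ineq2[of x "z *\<^sub>C C x"] by (simp add: algebra_simps)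
  have surj: "\<exists>x\<in>L. ?A x = y" if y: "y \<in> L" for y
  proof -
    have "\<exists>!x. x \<in> L \<and> y + z *\<^sub>C C x = x"
    proof (rule Banach_fix[of L "cmod z"])
      show "complete L" using LD(1) by (simp add: complete_eq_closed)
      show "L \<noteq> {}" "0 \<le> cmod z" "cmod z < 1" using LD(2) z by auto
      show "(\<lambda>x. y + z *\<^sub>C C x) ` L \<subseteq> L" using y by (intro image_subsetI LD(3) LD(4) CD(1))
      fix u v assume uv: "u \<in> L" "v \<in> L"
      show "dist (y + z *\<^sub>C C u) (y + z *\<^sub>C C v) \<le> cmod z * dist u v"
        using zC[OF LD(6)[OF uv]] bounded_op_diff[OF L contraction_opD(1)[OF C] uv]
        by (simp add: dist_norm scaleC_diff_right)
    qed
    then obtain x where "x \<in> L" "y + z *\<^sub>C C x = x" by blast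
    then show ?thesis by (intro bexI[of _ x]) (auto simp: diff_eq_eq)
  qed
  have inj: "x = y" if "x \<in> L" "y \<in> L" "?A x = ?A y" for x y
  proof -
    have "(1 - cmod z) * norm (x - y) \<le> 0"
      using below[OF LD(6)[OF that(1,2)]] A_diff[OF that(1,2)] that(3) by simp
    then show ?thesis using z by (simp add: mult_le_0_iff)
  qed
  define B where "B = inv_into L ?A"
  have B_in: "B y \<in> L" and AB: "?A (B y) = y" if "y \<in> L" for y
    using surj[OF that] unfolding B_def by (auto intro: inv_into_into f_inv_into_f[where f = ?A])
  have "bounded_op L L ?A"
    unfolding bounded_op_def
  proof (intro conjI ballI allI exI[of _ 2] A_in A_add A_scale)
    fix x assume x: "x \<in> L"
    have "cmod z * norm x \<le> norm x" using z by (simp add: mult_left_le_one_le)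
    then show "norm (?A x) \<le> 2 * norm x"
      using zC[OF x] norm_triangle_ineq4[of x "z *\<^sub>C C x"] by linarith
  qed
  moreover have "bounded_op L L B"
    unfolding bounded_op_def
  proof (intro conjI ballI allI exI[of _ "1 / (1 - cmod z)"] B_in)
    fix x y c assume x: "x \<in> L"
    show "B (x + y) = B x + B y" if y: "y \<in> L"
      by (rule inj) (simp_all only: LD B_in x y AB A_add)
    show "B (c *\<^sub>C x) = c *\<^sub>C B x"
      by (rule inj) (simp_all only: LD B_in x AB A_scale)
    show "norm (B x) \<le> 1 / (1 - cmod z) * norm x"
      using below[OF B_in[OF x]] z unfolding AB[OF x] by (simp add: field_simps)
  qed
  moreover have "B (?A x) = x" if "x \<in> L" for x
    by (rule inj) (simp_all only: that A_in B_in AB)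
  ultimately show ?thesis
    unfolding invertible_op_def using AB by (intro conjI exI[of _ B] ballI)
qed

section \<open>Elementary rotations and the Schur recursion\<close>

lemma norm_prod_sq: "(norm p)\<^sup>2 = (norm (fst p))\<^sup>2 + (norm (snd p))\<^sup>2"
  by (simp add: norm_prod_def)

lemma scaleC_Pair: "c *\<^sub>C (x, y) = (c *\<^sub>C x, c *\<^sub>C y)"
  by (simp add: scaleC_prod_def)

locale schur_parameters =
  fixes \<Gamma> :: "nat \<Rightarrow> 'm :: chilbert_space \<Rightarrow> 'n :: chilbert_space"
  assumes contractive: "contraction_op (src \<Gamma> k) (tgt \<Gamma> k) (\<Gamma> k)"
begin

lemma src_Suc: "src \<Gamma> (Suc k) = defect_space (src \<Gamma> k) (\<Gamma> k)"
  by (simp add: src_def)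

lemma tgt_Suc: "tgt \<Gamma> (Suc k) = defect_space (tgt \<Gamma> k) (adj (src \<Gamma> k) (\<Gamma> k))"
  by (simp add: src_def tgt_def)

lemma contraction_between_parameter: "contraction_between (src \<Gamma> k) (tgt \<Gamma> k) (\<Gamma> k)"
proof (induction k)
  case 0
  show ?case
    using contractive[of 0]
    by (intro contraction_between.intro) (simp_all add: src_def tgt_def closed_csubspace_UNIV)
next
  case (Suc k)
  then interpret G: contraction_between "src \<Gamma> k" "tgt \<Gamma> k" "\<Gamma> k" .
  interpret A: contraction_between "tgt \<Gamma> k" "src \<Gamma> k" "adj (src \<Gamma> k) (\<Gamma> k)" by (rule G.adjoint)
  show ?case
    using contractive[of "Suc k"] G.closed_csubspace_defect_space A.closed_csubspace_defect_space
    by (intro contraction_between.intro) (simp_all only: src_Suc tgt_Suc)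
qed

sublocale G: contraction_between "src \<Gamma> k" "tgt \<Gamma> k" "\<Gamma> k" for k
  by (rule contraction_between_parameter)

sublocale A: contraction_between "tgt \<Gamma> k" "src \<Gamma> k" "adj (src \<Gamma> k) (\<Gamma> k)" for k
  by (rule G.adjoint)

lemma tgt_Suc_subset: "tgt \<Gamma> (Suc k) \<subseteq> tgt \<Gamma> k"
  unfolding tgt_Suc by (rule A.defect_space_subset)

lemma \<Gamma>adj_in_src_Suc: "y \<in> tgt \<Gamma> (Suc k) \<Longrightarrow> \<Gamma>adj \<Gamma> k y \<in> src \<Gamma> (Suc k)"
  unfolding src_Suc tgt_Suc \<Gamma>adj_def by (rule G.adj_in_defect_space)

lemma D\<Gamma>_in_src_Suc: "x \<in> src \<Gamma> k \<Longrightarrow> D\<Gamma> \<Gamma> k x \<in> src \<Gamma> (Suc k)"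
  unfolding src_Suc D\<Gamma>_def by (rule G.defect_op_in_defect_space)

lemma rot_isometric:
  assumes "p \<in> src \<Gamma> k \<times> tgt \<Gamma> (Suc k)"
  shows "norm (rot \<Gamma> k p) = norm p"
proof -
  obtain x y where p: "p = (x, y)" "x \<in> src \<Gamma> k" "y \<in> tgt \<Gamma> k"
    using assms subsetD[OF tgt_Suc_subset] by (cases p) auto
  have "(norm (rot \<Gamma> k p))\<^sup>2 = (norm p)\<^sup>2"
    using G.rotation_isometric[OF p(2,3)]
    by (simp add: norm_prod_sq rot_def p(1) \<Gamma>adj_def D\<Gamma>_def D\<Gamma>adj_def)
  then show ?thesis by simp
qed

text \<open>
  The second component of the image lies in the defect space, so that the next parameter can act
  on it.
\<close>

lemma contraction_op_rot:
  "contraction_op (src \<Gamma> k \<times> tgt \<Gamma> (Suc k)) (tgt \<Gamma> k \<times> src \<Gamma> (Suc k)) (rot \<Gamma> k)"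
proof (rule contraction_opI)
  note lin = bounded_opD[OF G.G_op] bounded_opD[OF A.G_op]
    bounded_opD[OF G.bounded_op_defect_op] bounded_opD[OF A.bounded_op_defect_op]
  have src_Suc_closed: "x - y \<in> src \<Gamma> (Suc k)" if "x \<in> src \<Gamma> (Suc k)" "y \<in> src \<Gamma> (Suc k)" for x y
    using that by (rule closed_csubspaceD(6)[OF G.L])
  have tgt_closed: "x + y \<in> tgt \<Gamma> k" if "x \<in> tgt \<Gamma> k" "y \<in> tgt \<Gamma> k" for x y
    using that by (rule closed_csubspaceD(3)[OF G.L'])
  fix p q c assume p: "p \<in> src \<Gamma> k \<times> tgt \<Gamma> (Suc k)"
  obtain x y where xy: "p = (x, y)" "x \<in> src \<Gamma> k" "y \<in> tgt \<Gamma> (Suc k)" "y \<in> tgt \<Gamma> k"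
    using p subsetD[OF tgt_Suc_subset] by (cases p) auto
  show "rot \<Gamma> k p \<in> tgt \<Gamma> k \<times> src \<Gamma> (Suc k)"
    using xy(2-4) unfolding xy(1) rot_def D\<Gamma>adj_def \<Gamma>adj_def[of \<Gamma> k]
    by (simp add: tgt_closed lin(1,6,16) src_Suc_closed D\<Gamma>_in_src_Suc \<Gamma>adj_in_src_Suc[unfolded \<Gamma>adj_def])
  show "rot \<Gamma> k (p + q) = rot \<Gamma> k p + rot \<Gamma> k q" if q: "q \<in> src \<Gamma> k \<times> tgt \<Gamma> (Suc k)"
  proof -
    obtain x' y' where "q = (x', y')" "x' \<in> src \<Gamma> k" "y' \<in> tgt \<Gamma> k"
      using q subsetD[OF tgt_Suc_subset] by (cases q) auto
    then show ?thesis
      using xy(2,4) unfolding xy(1) rot_def D\<Gamma>adj_def \<Gamma>adj_def D\<Gamma>_def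
      by (simp add: lin(2,7,12,17))
  qed
  show "rot \<Gamma> k (c *\<^sub>C p) = c *\<^sub>C rot \<Gamma> k p"
    using xy(2,4) unfolding xy(1) rot_def D\<Gamma>adj_def \<Gamma>adj_def D\<Gamma>_def
    by (simp add: scaleC_Pair lin(3,8,13,18) scaleC_add_right scaleC_diff_right)
  show "norm (rot \<Gamma> k p) \<le> norm p" by (simp add: rot_isometric[OF p])
qed

lemma rot_zero [simp]: "rot \<Gamma> k 0 = 0"
  by (rule bounded_op_zero[OF closed_csubspace_Times contraction_opD(1)[OF contraction_op_rot]])
     (rule G.L A.L)+

end

text \<open>
  The Schur algorithm at a fixed point \<open>z\<close> of the disc; \<open>\<Theta> k\<close> stands for the operator \<open>\<Theta>\<^sub>k(z)\<close>.
\<close>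

locale schur_recursion = schur_parameters \<Gamma>
  for \<Gamma> :: "nat \<Rightarrow> 'm :: chilbert_space \<Rightarrow> 'n :: chilbert_space" +
  fixes z :: complex and \<Theta> :: "nat \<Rightarrow> 'm \<Rightarrow> 'n"
  assumes z: "cmod z < 1"
    and associated: "contraction_op (src \<Gamma> k) (tgt \<Gamma> k) (\<Theta> k)"
    and recursion: "x \<in> src \<Gamma> k \<Longrightarrow> \<Theta> k x = \<Gamma> k x + z *\<^sub>C D\<Gamma>adj \<Gamma> k (\<Theta> (Suc k)
          (inv_into (src \<Gamma> (Suc k)) (\<lambda>u. u + z *\<^sub>C \<Gamma>adj \<Gamma> k (\<Theta> (Suc k) u)) (D\<Gamma> \<Gamma> k x)))"
begin

text \<open>
  The vector \<open>(I + z \<Gamma>\<^sub>k\<^sup>* \<Theta>\<^sub>k\<^sub>+\<^sub>1(z))\<^sup>-\<^sup>1 D x\<close> of the recursion, with \<open>D\<close> the defect operator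
  of \<open>\<Gamma>\<^sub>k\<close>.
\<close>

definition next_vec :: "nat \<Rightarrow> 'm \<Rightarrow> 'm" where
  "next_vec k x = inv_into (src \<Gamma> (Suc k)) (\<lambda>u. u + z *\<^sub>C \<Gamma>adj \<Gamma> k (\<Theta> (Suc k) u)) (D\<Gamma> \<Gamma> k x)"

lemma \<Theta>_in_tgt: "x \<in> src \<Gamma> k \<Longrightarrow> \<Theta> k x \<in> tgt \<Gamma> k"
  by (rule bounded_opD(1)[OF contraction_opD(1)[OF associated]])

lemma next_vec:
  assumes x: "x \<in> src \<Gamma> k"
  shows "next_vec k x \<in> src \<Gamma> (Suc k)"
    "next_vec k x + z *\<^sub>C \<Gamma>adj \<Gamma> k (\<Theta> (Suc k) (next_vec k x)) = D\<Gamma> \<Gamma> k x"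
proof -
  have "contraction_op (tgt \<Gamma> (Suc k)) (src \<Gamma> (Suc k)) (\<Gamma>adj \<Gamma> k)"
    using A.G[of k] subsetD[OF tgt_Suc_subset, of _ k] \<Gamma>adj_in_src_Suc[of _ k]
    unfolding contraction_op_def bounded_op_def \<Gamma>adj_def by simp metis
  then have "contraction_op (src \<Gamma> (Suc k)) (src \<Gamma> (Suc k)) (\<Gamma>adj \<Gamma> k \<circ> \<Theta> (Suc k))"
    by (rule contraction_op_comp[OF associated])
  then have "invertible_op (src \<Gamma> (Suc k)) (\<lambda>u. u - (- z) *\<^sub>C (\<Gamma>adj \<Gamma> k \<circ> \<Theta> (Suc k)) u)"
    by (rule invertible_op_id_minus[OF G.L]) (simp add: z)
  moreover have "(- z) *\<^sub>C w = - (z *\<^sub>C w)" for w :: 'm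
    by (metis mult_minus1 scaleC_minus_one scaleC_scaleC)
  ultimately have inv: "invertible_op (src \<Gamma> (Suc k)) (\<lambda>u. u + z *\<^sub>C \<Gamma>adj \<Gamma> k (\<Theta> (Suc k) u))"
    by (simp add: o_def)
  show "next_vec k x \<in> src \<Gamma> (Suc k)"
    "next_vec k x + z *\<^sub>C \<Gamma>adj \<Gamma> k (\<Theta> (Suc k) (next_vec k x)) = D\<Gamma> \<Gamma> k x"
    using invertible_op_inv_into(1,2)[OF inv D\<Gamma>_in_src_Suc[OF x]] unfolding next_vec_def by simp_all
qed

text \<open>
  The first component is the recursion for \<open>\<Theta>\<^sub>k\<close>, the second the equation that defines the next
  vector. The linear fractional formula of the Schur algorithm has thus become a linear relation
  along one rotation.
\<close>

lemma rot_next_vec: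
  assumes x: "x \<in> src \<Gamma> k"
  shows "rot \<Gamma> k (x, z *\<^sub>C \<Theta> (Suc k) (next_vec k x)) = (\<Theta> k x, next_vec k x)"
proof -
  let ?y = "\<Theta> (Suc k) (next_vec k x)"
  have y: "?y \<in> tgt \<Gamma> k" using \<Theta>_in_tgt[OF next_vec(1)[OF x]] subsetD[OF tgt_Suc_subset] by blast
  have "D\<Gamma>adj \<Gamma> k (z *\<^sub>C ?y) = z *\<^sub>C D\<Gamma>adj \<Gamma> k ?y"
    unfolding D\<Gamma>adj_def \<Gamma>adj_def by (rule bounded_opD(3)[OF A.bounded_op_defect_op y])
  moreover have "\<Gamma>adj \<Gamma> k (z *\<^sub>C ?y) = z *\<^sub>C \<Gamma>adj \<Gamma> k ?y"
    unfolding \<Gamma>adj_def by (rule bounded_opD(3)[OF A.G_op y])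
  ultimately show ?thesis
    using recursion[OF x] next_vec(2)[OF x] unfolding next_vec_def[symmetric] rot_def
    by (simp add: diff_eq_eq)
qed

definition defect_form :: "nat \<Rightarrow> 'm \<Rightarrow> real" where
  "defect_form k x = (norm x)\<^sup>2 - (norm (\<Theta> k x))\<^sup>2"

lemma defect_form_nonneg: "x \<in> src \<Gamma> k \<Longrightarrow> 0 \<le> defect_form k x"
  using contraction_opD(2)[OF associated] unfolding defect_form_def by (simp add: power_mono)

lemma defect_form_scaleC:
  "x \<in> src \<Gamma> k \<Longrightarrow> defect_form k (c *\<^sub>C x) = (cmod c)\<^sup>2 * defect_form k x"
  unfolding defect_form_def
  by (simp add: bounded_opD(3)[OF contraction_opD(1)[OF associated]] norm_scaleC power_mult_distrib right_diff_distrib)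

text \<open>
  This is norm preservation by the rotation in \<open>rot_next_vec\<close>.
\<close>

lemma defect_form_next_vec:
  assumes x: "x \<in> src \<Gamma> k"
  shows "(norm (next_vec k x))\<^sup>2 - (cmod z)\<^sup>2 * (norm (\<Theta> (Suc k) (next_vec k x)))\<^sup>2 = defect_form k x"
proof -
  have "(x, z *\<^sub>C \<Theta> (Suc k) (next_vec k x)) \<in> src \<Gamma> k \<times> tgt \<Gamma> (Suc k)"
    using x closed_csubspaceD(4)[OF A.L \<Theta>_in_tgt[OF next_vec(1)[OF x]]] by simp
  from rot_isometric[OF this] have "(norm (\<Theta> k x, next_vec k x))\<^sup>2 = (norm (x, z *\<^sub>C \<Theta> (Suc k) (next_vec k x)))\<^sup>2"
    unfolding rot_next_vec[OF x] by simp
  then show ?thesis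
    by (simp add: norm_prod_sq norm_scaleC power_mult_distrib defect_form_def)
qed

text \<open>
  One step passes the rotation with index \<open>k + 2 i\<close> (in \<open>\<W>\<^sub>0\<close> when \<open>k\<close> is even) and then, after
  multiplication by \<open>z\<close>, the one with index \<open>k + 2 i + 1\<close> (in \<open>\<V>\<^sub>0\<close>).
\<close>

primrec chain :: "nat \<Rightarrow> 'm \<Rightarrow> nat \<Rightarrow> 'm" where
  "chain k u 0 = u"
| "chain k u (Suc i) = next_vec (Suc (k + 2*i)) (z *\<^sub>C next_vec (k + 2*i) (chain k u i))"

text \<open>
  With \<open>k = 2 n + 2\<close> and \<open>u\<close> the second component of entry \<open>n\<close> of a sequence, this is entry
  \<open>n + 1 + i\<close> of \<open>\<W>\<^sub>0\<close> applied to the extension of that sequence constructed below.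
\<close>

definition chain_pair :: "nat \<Rightarrow> 'm \<Rightarrow> nat \<Rightarrow> 'm \<times> 'n" where
  "chain_pair k u i = (next_vec (k + 2*i) (chain k u i), \<Theta> (k + 2*i + 2) (chain k u (Suc i)))"

context
  fixes k :: nat and u :: 'm
  assumes u: "u \<in> src \<Gamma> k"
begin

lemma chain_in_src: "chain k u i \<in> src \<Gamma> (k + 2*i)"
  and next_chain_in_src: "next_vec (k + 2*i) (chain k u i) \<in> src \<Gamma> (Suc (k + 2*i))"
proof -
  show c: "chain k u i \<in> src \<Gamma> (k + 2*i)" for i
  proof (induction i)
    case (Suc i)
    then have "z *\<^sub>C next_vec (k + 2*i) (chain k u i) \<in> src \<Gamma> (Suc (k + 2*i))"
      by (intro closed_csubspaceD(4)[OF G.L] next_vec(1))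
    from next_vec(1)[OF this] show ?case by simp
  qed (simp add: u)
  show "next_vec (k + 2*i) (chain k u i) \<in> src \<Gamma> (Suc (k + 2*i))"
    by (rule next_vec(1)[OF c])
qed

lemma chain_pair_in: "chain_pair k u i \<in> src \<Gamma> (k + 2*i + 1) \<times> tgt \<Gamma> (k + 2*i + 2)"
  using next_chain_in_src[of i] \<Theta>_in_tgt[OF chain_in_src[of "Suc i"]]
  by (simp add: chain_pair_def)

lemma rot_chain_pair:
  "rot \<Gamma> (k + 2*i + 1) (z *\<^sub>C chain_pair k u i)
    = (z *\<^sub>C \<Theta> (k + 2*i + 1) (fst (chain_pair k u i)), chain k u (Suc i))"
proof -
  let ?x = "next_vec (k + 2*i) (chain k u i)"
  have zx: "z *\<^sub>C ?x \<in> src \<Gamma> (Suc (k + 2*i))"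
    by (rule closed_csubspaceD(4)[OF G.L next_chain_in_src])
  show ?thesis
    using rot_next_vec[OF zx] bounded_opD(3)[OF contraction_opD(1)[OF associated] next_chain_in_src[of i], of z]
    by (simp add: chain_pair_def scaleC_Pair)
qed

lemma rot_chain:
  "rot \<Gamma> (k + 2*i) (chain k u i, z *\<^sub>C \<Theta> (k + 2*i + 1) (fst (chain_pair k u i)))
    = (\<Theta> (k + 2*i) (chain k u i), fst (chain_pair k u i))"
  using rot_next_vec[OF chain_in_src[of i]] by (simp add: chain_pair_def)

text \<open>
  Apply \<open>defect_form_next_vec\<close> at the two indices of a step. The factor \<open>z\<close> between the two
  rotations loses \<open>(1 - |z|\<^sup>2)\<close> times the squared norm of the first component, and the factor
  \<open>z\<close> in the second rotation loses the same multiple of that of the second component.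
\<close>

lemma chain_energy:
  "defect_form (k + 2 * Suc i) (chain k u (Suc i)) + (1 - (cmod z)\<^sup>2) * (norm (chain_pair k u i))\<^sup>2
    = defect_form (k + 2*i) (chain k u i)"
proof -
  let ?x = "next_vec (k + 2*i) (chain k u i)"
  have zx: "z *\<^sub>C ?x \<in> src \<Gamma> (Suc (k + 2*i))"
    by (rule closed_csubspaceD(4)[OF G.L next_chain_in_src])
  have "defect_form (Suc (k + 2*i)) (z *\<^sub>C ?x)
      = (cmod z)\<^sup>2 * ((norm ?x)\<^sup>2 - (norm (\<Theta> (Suc (k + 2*i)) ?x))\<^sup>2)"
    unfolding defect_form_scaleC[OF next_chain_in_src] by (simp add: defect_form_def)
  then have 1: "defect_form (Suc (k + 2*i)) (z *\<^sub>C ?x)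
      = defect_form (k + 2*i) (chain k u i) - (1 - (cmod z)\<^sup>2) * (norm ?x)\<^sup>2"
    using defect_form_next_vec[OF chain_in_src[of i]] by (simp add: algebra_simps)
  have "defect_form (k + 2 * Suc i) (chain k u (Suc i))
      = defect_form (Suc (k + 2*i)) (z *\<^sub>C ?x)
        - (1 - (cmod z)\<^sup>2) * (norm (\<Theta> (k + 2*i + 2) (chain k u (Suc i))))\<^sup>2"
    using defect_form_next_vec[OF zx] by (simp add: defect_form_def algebra_simps)
  then show ?thesis
    using 1 by (simp add: chain_pair_def norm_prod_sq algebra_simps)
qed

text \<open>
  The energy balance telescopes, and its last term is nonnegative.
\<close>

lemma summable_chain_pair: "summable (\<lambda>i. (norm (chain_pair k u i))\<^sup>2)"
proof (rule bounded_imp_summable)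
  have pos: "0 < 1 - (cmod z)\<^sup>2" using z by (simp add: power_less_one_iff abs_square_less_1)
  have eq: "defect_form (k + 2 * m) (chain k u m) + (1 - (cmod z)\<^sup>2) * (\<Sum>i<m. (norm (chain_pair k u i))\<^sup>2)
      = defect_form k u" for m
  proof (induction m)
    case (Suc m)
    then show ?case using chain_energy[of m] by (simp add: distrib_left)
  qed simp
  show "(\<Sum>i\<le>m. (norm (chain_pair k u i))\<^sup>2) \<le> defect_form k u / (1 - (cmod z)\<^sup>2)" for m
  proof -
    have "(1 - (cmod z)\<^sup>2) * (\<Sum>i<Suc m. (norm (chain_pair k u i))\<^sup>2) \<le> defect_form k u"
      using eq[of "Suc m"] defect_form_nonneg[OF chain_in_src[of "Suc m"]] by linarith
    then show ?thesis
      using pos by (simp add: pos_le_divide_eq mult.commute lessThan_Suc_atMost)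
  qed
qed simp

end

end

section \<open>Operators on orthogonal sums\<close>

lemma hnth_Abs_hsum_bounded:
  assumes "\<And>N. (\<Sum>j\<le>N. (norm (w j))\<^sup>2) \<le> B"
  shows "hnth (Abs_hsum w) = w"
  by (rule hnth_Abs, rule bounded_imp_summable[OF _ assms]) simp

lemma norm_Abs_hsum_le:
  fixes w :: "nat \<Rightarrow> 'a :: real_inner"
  assumes "\<And>N. (\<Sum>j\<le>N. (norm (w j))\<^sup>2) \<le> B\<^sup>2" "0 \<le> B"
  shows "norm (Abs_hsum w) \<le> B"
proof -
  have "(\<Sum>j. (norm (hnth (Abs_hsum w) j))\<^sup>2) \<le> B\<^sup>2"
    using summable_hnth[of "Abs_hsum w"] unfolding hnth_Abs_hsum_bounded[OF assms(1)]
    by (rule LIMSEQ_le_const2[OF summable_LIMSEQ']) (intro exI allI impI assms(1))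
  then show ?thesis
    unfolding norm_hsum_sq[symmetric] by (rule power2_le_imp_le[OF _ assms(2)])
qed

lemma sum_norm_hnth_le: "(\<Sum>j\<le>N. (norm (hnth f j))\<^sup>2) \<le> (norm (f :: 'a :: real_inner hsum))\<^sup>2"
  unfolding norm_hsum_sq by (rule sum_le_suminf) (auto simp: summable_hnth)

text \<open>
  An orthogonal sum of closed subspaces; all four sequence spaces are of this form, the
  truncated ones with \<open>{0}\<close> as the later summands.
\<close>

definition hsum_in :: "(nat \<Rightarrow> 'a :: complex_inner set) \<Rightarrow> 'a hsum set" where
  "hsum_in S = {f. \<forall>j. hnth f j \<in> S j}"

lemma hsum_in_truncated:
  assumes "\<And>j. 0 \<in> S j"
  shows "{f \<in> hsum_in S. \<forall>j>n. hnth f j = 0} = hsum_in (\<lambda>j. if j \<le> n then S j else {0})"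
proof -
  have "x \<in> S j \<and> (n < j \<longrightarrow> x = 0) \<longleftrightarrow> x \<in> (if j \<le> n then S j else {0})" for x j
    using assms[of j] by (cases "j \<le> n") auto
  then show ?thesis
    unfolding hsum_in_def mem_Collect_eq all_conj_distrib[symmetric] by presburger
qed

lemma closed_csubspace_hsum_in:
  assumes S: "\<And>j. closed_csubspace (S j)"
  shows "closed_csubspace (hsum_in S)"
  unfolding closed_csubspace_def
proof (intro conjI)
  have lim: "(\<lambda>i. hnth (f i) j) \<longlonglongrightarrow> hnth l j" if "f \<longlonglongrightarrow> l" for f :: "nat \<Rightarrow> 'a hsum" and l j
  proof (rule LIM_zero_cancel, rule Lim_null_comparison)
    have "norm (hnth (f i) j - hnth l j) \<le> norm (f i - l)" for i
      using norm_hnth_le[of "f i - l" j] by simp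
    then show "\<forall>\<^sub>F i in sequentially. norm (hnth (f i) j - hnth l j) \<le> norm (f i - l)" by simp
    show "(\<lambda>i. norm (f i - l)) \<longlonglongrightarrow> 0" using that by (simp add: tendsto_norm_zero LIM_zero)
  qed
  show "closed (hsum_in S)"
    unfolding closed_sequential_limits
  proof (intro allI impI, elim conjE)
    fix f l assume f: "\<forall>i. f i \<in> hsum_in S" "f \<longlonglongrightarrow> l"
    have "hnth l j \<in> S j" for j
      by (rule closed_sequentially[OF closed_csubspaceD(1)[OF S] _ lim[OF f(2)]])
         (use f(1) in \<open>simp add: hsum_in_def\<close>)
    then show "l \<in> hsum_in S" by (simp add: hsum_in_def)
  qed
qed (simp_all add: hsum_in_def closed_csubspaceD[OF S])

lemma contraction_op_entrywise:
  fixes w :: "'a :: complex_inner hsum \<Rightarrow> nat \<Rightarrow> 'b :: complex_inner"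
  assumes L: "L = hsum_in S" "L' = hsum_in S'" and A: "\<And>f. A f = Abs_hsum (w f)"
    and S: "\<And>j. closed_csubspace (S j)"
    and in_S': "\<And>f j. f \<in> L \<Longrightarrow> w f j \<in> S' j"
    and add: "\<And>f g j. f \<in> L \<Longrightarrow> g \<in> L \<Longrightarrow> w (f + g) j = w f j + w g j"
    and scale: "\<And>f c j. f \<in> L \<Longrightarrow> w (c *\<^sub>C f) j = c *\<^sub>C w f j"
    and bound: "\<And>f N. f \<in> L \<Longrightarrow> (\<Sum>j\<le>N. (norm (w f j))\<^sup>2) \<le> (norm f)\<^sup>2"
  shows "contraction_op L L' A"
proof (rule contraction_opI)
  have "closed_csubspace L" unfolding L(1) by (rule closed_csubspace_hsum_in[OF S])
  note LD = closed_csubspaceD[OF this]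
  have nth: "hnth (A f) = w f" if "f \<in> L" for f
    unfolding A by (rule hnth_Abs_hsum_bounded[OF bound[OF that]])
  fix f g c assume f: "f \<in> L"
  show "A f \<in> L'" using in_S'[OF f] by (simp add: L(2) hsum_in_def nth[OF f])
  show "A (f + g) = A f + A g" if g: "g \<in> L"
    by (rule hsum_eqI) (simp add: nth[OF f] nth[OF g] nth[OF LD(3)[OF f g]] add[OF f g])
  show "A (c *\<^sub>C f) = c *\<^sub>C A f"
    by (rule hsum_eqI) (simp add: nth[OF f] nth[OF LD(4)[OF f]] scale[OF f])
  show "norm (A f) \<le> norm f" unfolding A by (rule norm_Abs_hsum_le[OF bound[OF f]]) simp
qed

lemma orth_proj_unique:
  assumes L: "closed_csubspace L" and p: "p \<in> L" "\<And>u. u \<in> L \<Longrightarrow> cinner (h - p) u = 0"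
  shows "orth_proj L h = p"
  unfolding orth_proj_def
proof (rule the_equality)
  show "p \<in> L \<and> (\<forall>u\<in>L. cinner (h - p) u = 0)" using p by blast
  fix y assume y: "y \<in> L \<and> (\<forall>u\<in>L. cinner (h - y) u = 0)"
  have yp: "y - p \<in> L" using closed_csubspaceD(6)[OF L] y p(1) by blast
  have "cinner (y - p) (y - p) = cinner (h - p) (y - p) - cinner (h - y) (y - p)"
    by (simp flip: cinner_diff_left)
  also have "\<dots> = 0" using p(2)[OF yp] y yp by simp
  finally have "inner (y - p) (y - p) = 0" by (simp flip: Re_cinner)
  then show "y = p" by simp
qed

definition splice_at :: "nat \<Rightarrow> 'a hsum \<Rightarrow> (nat \<Rightarrow> 'a) \<Rightarrow> 'a :: real_normed_vector hsum" where
  "splice_at n f t = Abs_hsum (\<lambda>j. if j \<le> n then hnth f j else t (j - Suc n))"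

lemma hnth_splice_at:
  assumes "summable (\<lambda>i. (norm (t i))\<^sup>2)"
  shows "hnth (splice_at n f t) j = (if j \<le> n then hnth f j else t (j - Suc n))"
proof -
  have "summable (\<lambda>j. (norm (if j \<le> n then hnth f j else t (j - Suc n)))\<^sup>2)"
    by (rule iffD1[OF summable_iff_shift[of _ "Suc n"]]) (simp add: assms)
  then show ?thesis by (simp add: splice_at_def hnth_Abs)
qed

lemma orth_proj_splice_at:
  assumes t: "summable (\<lambda>i. (norm (t i))\<^sup>2)" and L: "closed_csubspace L"
    and zero: "\<And>u j. u \<in> L \<Longrightarrow> n < j \<Longrightarrow> hnth u j = 0" and f: "f \<in> L"
  shows "orth_proj L (splice_at n f t) = f"
proof (rule orth_proj_unique[OF L f])
  fix u assume u: "u \<in> L"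
  have "cinner (hnth (splice_at n f t - f) j) (hnth u j) = 0" for j
    using zero[OF u] by (cases "j \<le> n") (simp_all add: hnth_splice_at[OF t])
  then show "cinner (splice_at n f t - f) u = 0" by (simp add: cinner_hsum_def)
qed

text \<open>
  The block with index \<open>j + 1\<close> straddles the entries \<open>j\<close> and \<open>j + 1\<close>, so the partial sums of the
  two sides do not match; each side is completed by the half of the block that its partial sum
  leaves out.
\<close>

lemma sum_regrouped_le:
  fixes p :: "nat \<Rightarrow> 'a :: real_inner" and q :: "nat \<Rightarrow> 'b :: real_inner"
    and g :: "('c :: real_inner \<times> 'd :: real_inner) hsum"
  assumes first: "norm (p 0) \<le> norm (fst (hnth g 0))"
    and block: "\<And>j. (norm (q j))\<^sup>2 + (norm (p (Suc j)))\<^sup>2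
      \<le> (norm (snd (hnth g j)))\<^sup>2 + (norm (fst (hnth g (Suc j))))\<^sup>2"
  shows "(\<Sum>j\<le>N. (norm (p j, q j))\<^sup>2) \<le> (norm g)\<^sup>2"
proof -
  have step: "(\<Sum>j\<le>N. (norm (p j, q j))\<^sup>2) + (norm (p (Suc N)))\<^sup>2
      \<le> (\<Sum>j\<le>N. (norm (hnth g j))\<^sup>2) + (norm (fst (hnth g (Suc N))))\<^sup>2" for N
  proof (induction N)
    case 0
    have "(\<Sum>j\<le>0. (norm (p j, q j))\<^sup>2) = (norm (p 0))\<^sup>2 + (norm (q 0))\<^sup>2"
      "(\<Sum>j\<le>0. (norm (hnth g j))\<^sup>2) = (norm (fst (hnth g 0)))\<^sup>2 + (norm (snd (hnth g 0)))\<^sup>2"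
      by (simp_all add: norm_prod_sq)
    moreover have "(norm (p 0))\<^sup>2 \<le> (norm (fst (hnth g 0)))\<^sup>2"
      using first by (simp add: power_mono)
    ultimately show ?case using block[of 0] by linarith
  next
    case (Suc N)
    then show ?case using block[of "Suc N"] by (simp add: norm_prod_sq[of "hnth g (Suc N)"] norm_prod_sq[of "(_, _)"])
  qed
  have "(\<Sum>j\<le>N. (norm (p j, q j))\<^sup>2)
      \<le> (\<Sum>j\<le>N. (norm (hnth g j))\<^sup>2) + (norm (fst (hnth g (Suc N))))\<^sup>2"
    using step[of N] zero_le_power2[of "norm (p (Suc N))"] by linarith
  also have "\<dots> \<le> (\<Sum>j\<le>Suc N. (norm (hnth g j))\<^sup>2)"
    by (simp add: norm_prod_sq[of "hnth g (Suc N)"])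
  also have "\<dots> \<le> (norm g)\<^sup>2" by (rule sum_norm_hnth_le)
  finally show ?thesis .
qed


section \<open>Truncated CMV matrices\<close>

context schur_parameters
begin

lemma HH_eq: "HH \<Gamma> = hsum_in (\<lambda>j. src \<Gamma> (2*j + 1) \<times> tgt \<Gamma> (2*j + 2))"
  by (simp add: HH_def hsum_in_def)

lemma HHt_eq: "HHt \<Gamma> = hsum_in (\<lambda>j. tgt \<Gamma> (2*j + 1) \<times> src \<Gamma> (2*j + 2))"
  by (simp add: HHt_def hsum_in_def)

lemma closed_csubspace_zero: "closed_csubspace {0}"
  by (simp add: closed_csubspace_def)

lemma zero_in_summand [simp]: "0 \<in> src \<Gamma> k \<times> tgt \<Gamma> l" "0 \<in> tgt \<Gamma> l \<times> src \<Gamma> k"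
  by (rule closed_csubspaceD(2)[OF closed_csubspace_Times]; rule G.L A.L)+

lemma KK_eq: "KK \<Gamma> n = hsum_in (\<lambda>j. if j \<le> n then src \<Gamma> (2*j + 1) \<times> tgt \<Gamma> (2*j + 2) else {0})"
  unfolding KK_def HH_eq by (rule hsum_in_truncated) (rule zero_in_summand)

lemma KKt_eq: "KKt \<Gamma> n = hsum_in (\<lambda>j. if j \<le> n then tgt \<Gamma> (2*j + 1) \<times> src \<Gamma> (2*j + 2) else {0})"
  unfolding KKt_def HHt_eq by (rule hsum_in_truncated) (rule zero_in_summand)

lemmas summand_closed = closed_csubspace_Times[OF G.L A.L] closed_csubspace_Times[OF A.L G.L]

lemma closed_csubspace_sums:
  "closed_csubspace (HH \<Gamma>)" "closed_csubspace (HHt \<Gamma>)" "closed_csubspace (KK \<Gamma> n)" "closed_csubspace (KKt \<Gamma> n)"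
  unfolding HH_eq HHt_eq KK_eq KKt_eq
  by (intro closed_csubspace_hsum_in; simp add: summand_closed closed_csubspace_zero)+

lemma rot_props:
  assumes "p \<in> src \<Gamma> k \<times> tgt \<Gamma> (Suc k)"
  shows "rot \<Gamma> k p \<in> tgt \<Gamma> k \<times> src \<Gamma> (Suc k)" "rot \<Gamma> k (c *\<^sub>C p) = c *\<^sub>C rot \<Gamma> k p"
    "q \<in> src \<Gamma> k \<times> tgt \<Gamma> (Suc k) \<Longrightarrow> rot \<Gamma> k (p + q) = rot \<Gamma> k p + rot \<Gamma> k q"
  using bounded_opD(1-3)[OF contraction_opD(1)[OF contraction_op_rot]] assms by blast+

lemma HH_nth: "f \<in> HH \<Gamma> \<Longrightarrow> hnth f j \<in> src \<Gamma> (2*j + 1) \<times> tgt \<Gamma> (Suc (2*j + 1))"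
  by (simp add: HH_def)

lemma KK_nth: "f \<in> KK \<Gamma> n \<Longrightarrow> hnth f j \<in> src \<Gamma> (2*j + 1) \<times> tgt \<Gamma> (Suc (2*j + 1))"
  by (simp add: KK_def HH_def)

lemma sum_rot_le:
  assumes "f \<in> HH \<Gamma>"
  shows "(\<Sum>j\<le>N. (norm (rot \<Gamma> (2*j + 1) (hnth f j)))\<^sup>2) \<le> (norm f)\<^sup>2"
  using sum_norm_hnth_le[of f N] by (simp only: rot_isometric[OF HH_nth[OF assms]])

lemma hnth_V0: "f \<in> HH \<Gamma> \<Longrightarrow> hnth (V0 \<Gamma> f) j = rot \<Gamma> (2*j + 1) (hnth f j)"
  unfolding V0_def by (subst hnth_Abs_hsum_bounded[OF sum_rot_le]) simp_all

lemma contraction_op_V0: "contraction_op (HH \<Gamma>) (HHt \<Gamma>) (V0 \<Gamma>)"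
proof (rule contraction_op_entrywise[OF HH_eq HHt_eq V0_def])
  fix f g N j c assume f: "f \<in> HH \<Gamma>"
  show "(\<Sum>j\<le>N. (norm (rot \<Gamma> (2*j + 1) (hnth f j)))\<^sup>2) \<le> (norm f)\<^sup>2" by (rule sum_rot_le[OF f])
  show "rot \<Gamma> (2*j + 1) (hnth f j) \<in> tgt \<Gamma> (2*j + 1) \<times> src \<Gamma> (2*j + 2)"
    using rot_props(1)[OF HH_nth[OF f]] by simp
  show "rot \<Gamma> (2*j + 1) (hnth (c *\<^sub>C f) j) = c *\<^sub>C rot \<Gamma> (2*j + 1) (hnth f j)"
    unfolding hnth_scaleC by (rule rot_props(2)[OF HH_nth[OF f]])
  show "rot \<Gamma> (2*j + 1) (hnth (f + g) j) = rot \<Gamma> (2*j + 1) (hnth f j) + rot \<Gamma> (2*j + 1) (hnth g j)"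
    if "g \<in> HH \<Gamma>"
    unfolding hnth_add by (rule rot_props(3)[OF HH_nth[OF f] HH_nth[OF that]])
qed (rule summand_closed)

lemma KK_subset: "f \<in> KK \<Gamma> n \<Longrightarrow> f \<in> HH \<Gamma>" and KKt_subset: "g \<in> KKt \<Gamma> n \<Longrightarrow> g \<in> HHt \<Gamma>"
  by (simp_all add: KK_def KKt_def)

text \<open>
  The rotations map the zero entries beyond \<open>n\<close> to zero.
\<close>

lemma Vn_eq_V0: "f \<in> KK \<Gamma> n \<Longrightarrow> Vn \<Gamma> n f = V0 \<Gamma> f"
  unfolding Vn_def V0_def by (rule arg_cong[of _ _ Abs_hsum]) (auto simp: KK_def)

lemma contraction_op_Vn: "contraction_op (KK \<Gamma> n) (KKt \<Gamma> n) (Vn \<Gamma> n)"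
proof (rule contraction_opI)
  note V = bounded_opD[OF contraction_opD(1)[OF contraction_op_V0]]
  note K = closed_csubspaceD[OF closed_csubspace_sums(3)]
  fix f g c assume f: "f \<in> KK \<Gamma> n"
  note f' = KK_subset[OF f]
  have "hnth (V0 \<Gamma> f) j = 0" if "j > n" for j
    using that f hnth_V0[OF f', of j] by (simp add: KK_def)
  then show "Vn \<Gamma> n f \<in> KKt \<Gamma> n" using V(1)[OF f'] by (simp add: Vn_eq_V0[OF f] KKt_def)
  show "Vn \<Gamma> n (f + g) = Vn \<Gamma> n f + Vn \<Gamma> n g" if "g \<in> KK \<Gamma> n"
    using V(2)[OF f' KK_subset[OF that]] by (simp add: Vn_eq_V0 f that K)
  show "Vn \<Gamma> n (c *\<^sub>C f) = c *\<^sub>C Vn \<Gamma> n f" using V(3)[OF f'] by (simp add: Vn_eq_V0 f K)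
  show "norm (Vn \<Gamma> n f) \<le> norm f"
    using contraction_opD(2)[OF contraction_op_V0 f'] by (simp add: Vn_eq_V0 f)
qed

text \<open>
  The first component of entry \<open>j\<close> of \<open>\<W>\<^sub>0 g\<close>.
\<close>

definition W_fst :: "nat \<Rightarrow> ('n \<times> 'm) hsum \<Rightarrow> 'm" where
  "W_fst j g = (if j = 0 then - \<Gamma>adj \<Gamma> 0 (fst (hnth g 0)) else snd (even_block \<Gamma> j g))"

lemma HHt_entry: "g \<in> HHt \<Gamma> \<Longrightarrow> hnth g j \<in> tgt \<Gamma> (2*j + 1) \<times> src \<Gamma> (2*j + 2)"
  by (simp add: HHt_def)

lemma HHt_even_input: "g \<in> HHt \<Gamma> \<Longrightarrow>
    (snd (hnth g j), fst (hnth g (Suc j))) \<in> src \<Gamma> (2 * Suc j) \<times> tgt \<Gamma> (Suc (2 * Suc j))"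
  using HHt_entry[of g j] HHt_entry[of g "Suc j"] by (simp add: mem_Times_iff)

lemma HHt_first_input: "g \<in> HHt \<Gamma> \<Longrightarrow> fst (hnth g 0) \<in> tgt \<Gamma> (Suc 0) \<and> fst (hnth g 0) \<in> tgt \<Gamma> 0"
  using HHt_entry[of g 0] subsetD[OF tgt_Suc_subset[of 0]] by (simp add: mem_Times_iff)

lemma even_block_Suc: "even_block \<Gamma> (Suc j) g = rot \<Gamma> (2 * Suc j) (snd (hnth g j), fst (hnth g (Suc j)))"
  by (simp add: even_block_def)

lemma even_block_props:
  assumes g: "g \<in> HHt \<Gamma>"
  shows "even_block \<Gamma> (Suc j) g \<in> tgt \<Gamma> (2 * Suc j) \<times> src \<Gamma> (Suc (2 * Suc j))"
    "even_block \<Gamma> (Suc j) (c *\<^sub>C g) = c *\<^sub>C even_block \<Gamma> (Suc j) g"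
    "h \<in> HHt \<Gamma> \<Longrightarrow> even_block \<Gamma> (Suc j) (g + h) = even_block \<Gamma> (Suc j) g + even_block \<Gamma> (Suc j) h"
    "(norm (fst (even_block \<Gamma> (Suc j) g)))\<^sup>2 + (norm (snd (even_block \<Gamma> (Suc j) g)))\<^sup>2
      = (norm (snd (hnth g j)))\<^sup>2 + (norm (fst (hnth g (Suc j))))\<^sup>2"
proof -
  note g' = HHt_even_input[OF g, of j]
  show "even_block \<Gamma> (Suc j) g \<in> tgt \<Gamma> (2 * Suc j) \<times> src \<Gamma> (Suc (2 * Suc j))"
    unfolding even_block_Suc by (rule rot_props(1)[OF g'])
  show "even_block \<Gamma> (Suc j) (c *\<^sub>C g) = c *\<^sub>C even_block \<Gamma> (Suc j) g"
    using rot_props(2)[OF g', of c] by (simp add: even_block_Suc scaleC_prod_def)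
  show "even_block \<Gamma> (Suc j) (g + h) = even_block \<Gamma> (Suc j) g + even_block \<Gamma> (Suc j) h" if "h \<in> HHt \<Gamma>"
    using rot_props(3)[OF g' HHt_even_input[OF that]] by (simp add: even_block_Suc)
  show "(norm (fst (even_block \<Gamma> (Suc j) g)))\<^sup>2 + (norm (snd (even_block \<Gamma> (Suc j) g)))\<^sup>2
      = (norm (snd (hnth g j)))\<^sup>2 + (norm (fst (hnth g (Suc j))))\<^sup>2"
    using arg_cong[OF rot_isometric[OF g'], of "\<lambda>r. r\<^sup>2"] unfolding even_block_Suc norm_prod_sq by simp
qed

lemma W_fst_props:
  assumes g: "g \<in> HHt \<Gamma>"
  shows "W_fst j g \<in> src \<Gamma> (2*j + 1)" "W_fst j (c *\<^sub>C g) = c *\<^sub>C W_fst j g"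
    "h \<in> HHt \<Gamma> \<Longrightarrow> W_fst j (g + h) = W_fst j g + W_fst j h"
proof -
  show "W_fst j g \<in> src \<Gamma> (2*j + 1)"
  proof (cases j)
    case 0
    then show ?thesis
      using closed_csubspaceD(5)[OF G.L \<Gamma>adj_in_src_Suc[OF conjunct1[OF HHt_first_input[OF g]]]]
      by (simp add: W_fst_def)
  next
    case (Suc i)
    then show ?thesis using even_block_props(1)[OF g, of i] by (auto simp: W_fst_def mem_Times_iff)
  qed
  show "W_fst j (c *\<^sub>C g) = c *\<^sub>C W_fst j g"
    using bounded_opD(3)[OF A.G_op conjunct2[OF HHt_first_input[OF g]]] even_block_props(2)[OF g, of "j - 1"]
    by (cases j) (simp_all add: W_fst_def \<Gamma>adj_def scaleC_prod_def scaleC_minus_right)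
  show "W_fst j (g + h) = W_fst j g + W_fst j h" if h: "h \<in> HHt \<Gamma>"
    using bounded_opD(2)[OF A.G_op conjunct2[OF HHt_first_input[OF g]] conjunct2[OF HHt_first_input[OF h]]]
      even_block_props(3)[OF g h, of "j - 1"]
    by (cases j) (simp_all add: W_fst_def \<Gamma>adj_def)
qed

lemma W_fst_0_norm:
  assumes g: "g \<in> HHt \<Gamma>"
  shows "norm (W_fst 0 g) \<le> norm (fst (hnth g 0))"
  using contraction_opD(2)[OF A.G conjunct2[OF HHt_first_input[OF g]]] by (simp add: W_fst_def \<Gamma>adj_def)

lemma sum_W0_le:
  assumes g: "g \<in> HHt \<Gamma>"
  shows "(\<Sum>j\<le>N. (norm (W_fst j g, fst (even_block \<Gamma> (Suc j) g)))\<^sup>2) \<le> (norm g)\<^sup>2"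
  by (rule sum_regrouped_le[where g = g])
     (use W_fst_0_norm[OF g] even_block_props(4)[OF g] in \<open>simp_all add: W_fst_def\<close>)

lemma W0_eq: "W0 \<Gamma> g = Abs_hsum (\<lambda>j. (W_fst j g, fst (even_block \<Gamma> (Suc j) g)))"
  by (simp add: W0_def W_fst_def)

lemma hnth_W0: "g \<in> HHt \<Gamma> \<Longrightarrow> hnth (W0 \<Gamma> g) j = (W_fst j g, fst (even_block \<Gamma> (Suc j) g))"
  unfolding W0_eq by (subst hnth_Abs_hsum_bounded[OF sum_W0_le]) simp_all

lemma contraction_op_W0: "contraction_op (HHt \<Gamma>) (HH \<Gamma>) (W0 \<Gamma>)"
proof (rule contraction_op_entrywise[OF HHt_eq HH_eq W0_eq])
  fix g h N j c assume g: "g \<in> HHt \<Gamma>"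
  show "(\<Sum>j\<le>N. (norm (W_fst j g, fst (even_block \<Gamma> (Suc j) g)))\<^sup>2) \<le> (norm g)\<^sup>2"
    by (rule sum_W0_le[OF g])
  show "(W_fst j g, fst (even_block \<Gamma> (Suc j) g)) \<in> src \<Gamma> (2*j + 1) \<times> tgt \<Gamma> (2*j + 2)"
    using W_fst_props(1)[OF g, of j] even_block_props(1)[OF g, of j] by (auto simp: mem_Times_iff)
  show "(W_fst j (c *\<^sub>C g), fst (even_block \<Gamma> (Suc j) (c *\<^sub>C g)))
      = c *\<^sub>C (W_fst j g, fst (even_block \<Gamma> (Suc j) g))"
    by (simp add: W_fst_props(2)[OF g] even_block_props(2)[OF g] scaleC_prod_def)
  show "(W_fst j (g + h), fst (even_block \<Gamma> (Suc j) (g + h)))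
      = (W_fst j g, fst (even_block \<Gamma> (Suc j) g)) + (W_fst j h, fst (even_block \<Gamma> (Suc j) h))"
    if "h \<in> HHt \<Gamma>"
    by (simp add: W_fst_props(3)[OF g that] even_block_props(3)[OF g that])
qed (rule summand_closed)

lemma KKt_nth_n: "g \<in> KKt \<Gamma> n \<Longrightarrow> snd (hnth g n) \<in> src \<Gamma> (2*n + 2)"
  using HHt_even_input[of g n] KKt_subset by auto

context
  fixes n :: nat and G :: "'m \<Rightarrow> 'n"
  assumes G: "contraction_op (src \<Gamma> (2*n + 2)) (tgt \<Gamma> (2*n + 2)) G"
begin

definition Wn_nth :: "nat \<Rightarrow> ('n \<times> 'm) hsum \<Rightarrow> 'm \<times> 'n" where
  "Wn_nth j g = (if j \<le> n then W_fst j g else 0,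
     if j < n then fst (even_block \<Gamma> (Suc j) g) else if j = n then G (snd (hnth g n)) else 0)"

lemma Wn_eq: "Wn \<Gamma> n G g = Abs_hsum (\<lambda>j. Wn_nth j g)"
  unfolding Wn_def by (rule arg_cong[of _ _ Abs_hsum]) (auto simp: Wn_nth_def W_fst_def zero_prod_def)

lemma sum_Wn_le:
  assumes g: "g \<in> KKt \<Gamma> n"
  shows "(\<Sum>j\<le>N. (norm (Wn_nth j g))\<^sup>2) \<le> (norm g)\<^sup>2"
  unfolding Wn_nth_def
proof (rule sum_regrouped_le[where g = g])
  note g' = KKt_subset[OF g]
  show "norm (if 0 \<le> n then W_fst 0 g else 0) \<le> norm (fst (hnth g 0))"
    using W_fst_0_norm[OF g'] by simp
  fix j
  have "(norm (G (snd (hnth g n))))\<^sup>2 \<le> (norm (snd (hnth g n)))\<^sup>2"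
    using contraction_opD(2)[OF G KKt_nth_n[OF g]] by (simp add: power_mono)
  then have "(norm (G (snd (hnth g n))))\<^sup>2
      \<le> (norm (snd (hnth g n)))\<^sup>2 + (norm (fst (hnth g (Suc n))))\<^sup>2"
    by (rule add_increasing2[OF zero_le_power2])
  then show "(norm (if j < n then fst (even_block \<Gamma> (Suc j) g) else if j = n then G (snd (hnth g n)) else 0))\<^sup>2
      + (norm (if Suc j \<le> n then W_fst (Suc j) g else 0))\<^sup>2
    \<le> (norm (snd (hnth g j)))\<^sup>2 + (norm (fst (hnth g (Suc j))))\<^sup>2"
    using even_block_props(4)[OF g', of j] by (auto simp: W_fst_def intro: order_trans)
qed

lemma hnth_Wn: "g \<in> KKt \<Gamma> n \<Longrightarrow> hnth (Wn \<Gamma> n G g) j = Wn_nth j g"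
  unfolding Wn_eq by (subst hnth_Abs_hsum_bounded[OF sum_Wn_le]) simp_all

lemma contraction_op_Wn: "contraction_op (KKt \<Gamma> n) (KK \<Gamma> n) (Wn \<Gamma> n G)"
proof (rule contraction_op_entrywise[OF KKt_eq KK_eq Wn_eq])
  note GD = bounded_opD[OF contraction_opD(1)[OF G]]
  fix g h N j c assume g: "g \<in> KKt \<Gamma> n"
  note g' = KKt_subset[OF g] and gn = KKt_nth_n[OF g]
  show "(\<Sum>j\<le>N. (norm (Wn_nth j g))\<^sup>2) \<le> (norm g)\<^sup>2" by (rule sum_Wn_le[OF g])
  show "Wn_nth j g \<in> (if j \<le> n then src \<Gamma> (2*j + 1) \<times> tgt \<Gamma> (2*j + 2) else {0})"
    using W_fst_props(1)[OF g', of j] even_block_props(1)[OF g', of j] GD(1)[OF gn]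
    by (auto simp: Wn_nth_def mem_Times_iff zero_prod_def)
  show "Wn_nth j (c *\<^sub>C g) = c *\<^sub>C Wn_nth j g"
    by (simp add: Wn_nth_def W_fst_props(2)[OF g'] even_block_props(2)[OF g'] GD(3)[OF gn] scaleC_prod_def)
  show "Wn_nth j (g + h) = Wn_nth j g + Wn_nth j h" if h: "h \<in> KKt \<Gamma> n"
    by (simp add: Wn_nth_def W_fst_props(3)[OF g' KKt_subset[OF h]]
        even_block_props(3)[OF g' KKt_subset[OF h]] GD(2)[OF gn KKt_nth_n[OF h]])
qed (simp add: summand_closed closed_csubspace_zero)

lemmas contraction_op_Sn = contraction_op_comp[OF contraction_op_Vn contraction_op_Wn]
lemmas contraction_op_Snt = contraction_op_comp[OF contraction_op_Wn contraction_op_Vn]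

end

lemmas contraction_op_T0 = contraction_op_comp[OF contraction_op_V0 contraction_op_W0]
lemmas contraction_op_T0t = contraction_op_comp[OF contraction_op_W0 contraction_op_V0]

end

section \<open>Compressed resolvents\<close>

lemma summable_scaleC:
  fixes f :: "nat \<Rightarrow> 'a :: complex_inner"
  shows "summable (\<lambda>i. (norm (f i))\<^sup>2) \<Longrightarrow> summable (\<lambda>i. (norm (c *\<^sub>C f i))\<^sup>2)"
  by (simp add: norm_scaleC power_mult_distrib summable_mult)

context schur_recursion
begin

context
  fixes n :: nat
begin

text \<open>
  The homogeneous part of the solution: the chain is started at \<open>\<Gamma>\<^sub>2\<^sub>n\<^sub>+\<^sub>2\<close> with the component
  of \<open>q\<close> that the first block beyond the truncation receives.
\<close>

definition tail :: "('n \<times> 'm) hsum \<Rightarrow> nat \<Rightarrow> 'm \<times> 'n" where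
  "tail q = chain_pair (2*n + 2) (snd (hnth q n))"

definition tail_image :: "('n \<times> 'm) hsum \<Rightarrow> nat \<Rightarrow> 'n \<times> 'm" where
  "tail_image q i = rot \<Gamma> (2*n + 2 + 2*i + 1) (z *\<^sub>C tail q i)"

abbreviation extend :: "('n \<times> 'm) hsum \<Rightarrow> ('n \<times> 'm) hsum" where
  "extend q \<equiv> splice_at n q (tail_image q)"

abbreviation T where "T \<equiv> \<Theta> (2*n + 2)"

context
  fixes q
  assumes q: "q \<in> KKt \<Gamma> n"
begin

lemmas q_n = KKt_nth_n[OF q]

lemma tail_in: "z *\<^sub>C tail q i \<in> src \<Gamma> (2*n + 2 + 2*i + 1) \<times> tgt \<Gamma> (Suc (2*n + 2 + 2*i + 1))"
  using closed_csubspaceD(4)[OF closed_csubspace_Times[OF G.L A.L] chain_pair_in[OF q_n]]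
  by (simp add: tail_def)

lemma summable_tail: "summable (\<lambda>i. (norm (z *\<^sub>C tail q i))\<^sup>2)"
  unfolding tail_def by (rule summable_scaleC[OF summable_chain_pair[OF q_n]])

lemma summable_tail_image: "summable (\<lambda>i. (norm (tail_image q i))\<^sup>2)"
  using summable_tail unfolding tail_image_def rot_isometric[OF tail_in] .

lemmas hnth_extend = hnth_splice_at[OF summable_tail_image]

lemma extend_in: "extend q \<in> HHt \<Gamma>"
  unfolding HHt_def
proof (intro CollectI allI)
  fix j
  show "hnth (extend q) j \<in> tgt \<Gamma> (2*j + 1) \<times> src \<Gamma> (2*j + 2)"
  proof (cases "j \<le> n")
    case True
    then show ?thesis using HHt_entry[OF KKt_subset[OF q]] by (simp add: hnth_extend)
  next
    case False
    then obtain i where "j = Suc (n + i)" using less_imp_Suc_add not_le by blast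
    then show ?thesis using rot_props(1)[OF tail_in[of i]] by (simp add: hnth_extend tail_image_def)
  qed
qed

text \<open>
  In the extended sequence each even block beyond the truncation has exactly the input of
  \<open>rot_next_vec\<close>. For \<open>i = 0\<close> the first component of its output is \<open>\<Theta>\<^sub>2\<^sub>n\<^sub>+\<^sub>2(z)\<close> applied to the
  last component of \<open>q\<close>.
\<close>

lemma even_block_extend:
  "even_block \<Gamma> (Suc (n + i)) (extend q)
    = (\<Theta> (2*n + 2 + 2*i) (chain (2*n + 2) (snd (hnth q n)) i), fst (tail q i))"
proof -
  let ?k = "2*n + 2" and ?u = "snd (hnth q n)"
  have img: "tail_image q i = (z *\<^sub>C \<Theta> (?k + 2*i + 1) (fst (tail q i)), chain ?k ?u (Suc i))" for i
    unfolding tail_image_def tail_def by (rule rot_chain_pair[OF q_n])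
  have "snd (hnth (extend q) (n + i)) = chain ?k ?u i"
    by (cases i) (simp_all add: hnth_extend img del: chain.simps(2))
  moreover have "fst (hnth (extend q) (Suc (n + i))) = z *\<^sub>C \<Theta> (?k + 2*i + 1) (fst (tail q i))"
    by (simp add: hnth_extend img)
  moreover have "2 * Suc (n + i) = ?k + 2*i" by simp
  ultimately show ?thesis
    using rot_chain[OF q_n, of i] unfolding even_block_Suc by (simp only: tail_def)
qed

text \<open>
  On the entries up to \<open>n\<close> the infinite matrix acts on the extended sequence as the truncated
  one does on \<open>q\<close>, because the output of the first block beyond them is the bottom block of the
  truncated matrix. On the later entries it reproduces the tail from which the extension was
  built.
\<close>

lemma W0_extend: "W0 \<Gamma> (extend q) = splice_at n (Wn \<Gamma> n T q) (tail q)"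
proof (rule hsum_eqI)
  fix j
  have sum: "summable (\<lambda>i. (norm (tail q i))\<^sup>2)"
    unfolding tail_def by (rule summable_chain_pair[OF q_n])
  show "hnth (W0 \<Gamma> (extend q)) j = hnth (splice_at n (Wn \<Gamma> n T q) (tail q)) j"
  proof (cases "j \<le> n")
    case True
    have below: "even_block \<Gamma> (Suc i) (extend q) = even_block \<Gamma> (Suc i) q" if "i < n" for i
      using that by (simp add: even_block_Suc hnth_extend)
    have "W_fst j (extend q) = W_fst j q"
      using True below[of "j - 1"] by (cases j) (simp_all add: W_fst_def hnth_extend)
    moreover have "fst (even_block \<Gamma> (Suc j) (extend q))
        = (if j < n then fst (even_block \<Gamma> (Suc j) q) else T (snd (hnth q n)))"
      using True below[of j] even_block_extend[of 0] by (cases "j = n") simp_all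
    ultimately show ?thesis
      using True
      unfolding hnth_W0[OF extend_in] hnth_splice_at[OF sum] hnth_Wn[OF associated q] Wn_nth_def[OF associated]
      by simp
  next
    case False
    then obtain i where j: "j = Suc (n + i)" using less_imp_Suc_add not_le by blast
    have "W_fst j (extend q) = fst (tail q i)"
      using even_block_extend[of i] by (simp add: j W_fst_def)
    moreover have "fst (even_block \<Gamma> (Suc j) (extend q)) = snd (tail q i)"
      using even_block_extend[of "Suc i"] by (simp add: j tail_def chain_pair_def del: chain.simps(2))
    ultimately show ?thesis
      by (simp add: hnth_W0[OF extend_in] hnth_splice_at[OF sum]) (simp add: j)
  qed
qed

end

text \<open>
  Beyond \<open>n\<close> the sequence \<open>h\<close> is \<open>z\<close> times the tail, and \<open>\<T>\<^sub>0 h\<close> is the tail, so these entries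
  cancel in \<open>h - z \<T>\<^sub>0 h\<close>.
\<close>

lemma resolvent_T0:
  assumes p: "p \<in> KK \<Gamma> n"
  defines "h \<equiv> splice_at n p (\<lambda>i. z *\<^sub>C tail (Vn \<Gamma> n p) i)"
  shows "h \<in> HH \<Gamma>" "h - z *\<^sub>C T0 \<Gamma> h = p - z *\<^sub>C Sn \<Gamma> n T p" "orth_proj (KK \<Gamma> n) h = p"
proof -
  let ?q = "Vn \<Gamma> n p"
  have q: "?q \<in> KKt \<Gamma> n" by (rule bounded_opD(1)[OF contraction_opD(1)[OF contraction_op_Vn] p])
  note sum = summable_tail[OF q]
  have nth: "hnth h j = (if j \<le> n then hnth p j else z *\<^sub>C tail ?q (j - Suc n))" for j
    unfolding h_def by (rule hnth_splice_at[OF sum])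
  show h: "h \<in> HH \<Gamma>"
    unfolding HH_def
  proof (intro CollectI allI)
    fix j
    show "hnth h j \<in> src \<Gamma> (2*j + 1) \<times> tgt \<Gamma> (2*j + 2)"
    proof (cases "j \<le> n")
      case True
      then show ?thesis using KK_nth[OF p] by (simp add: nth)
    next
      case False
      then obtain i where "j = Suc (n + i)" using less_imp_Suc_add not_le by blast
      then show ?thesis using tail_in[OF q, of i] by (simp add: nth)
    qed
  qed
  have "V0 \<Gamma> h = extend ?q"
  proof (rule hsum_eqI)
    fix j
    have Vp: "hnth ?q j = rot \<Gamma> (2*j + 1) (hnth p j)"
      unfolding Vn_eq_V0[OF p] by (rule hnth_V0[OF KK_subset[OF p]])
    show "hnth (V0 \<Gamma> h) j = hnth (extend ?q) j"
      unfolding hnth_V0[OF h] nth hnth_extend[OF q]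
    proof (cases "j \<le> n")
      case False
      then obtain i where "j = Suc (n + i)" using less_imp_Suc_add not_le by blast
      then show "rot \<Gamma> (2*j + 1) (if j \<le> n then hnth p j else z *\<^sub>C tail ?q (j - Suc n))
          = (if j \<le> n then hnth ?q j else tail_image ?q (j - Suc n))"
        by (simp add: tail_image_def)
    qed (simp add: Vp)
  qed
  then have T0: "T0 \<Gamma> h = splice_at n (Sn \<Gamma> n T p) (tail ?q)"
    by (simp add: T0_def Sn_def W0_extend[OF q])
  have Sn: "Sn \<Gamma> n T p \<in> KK \<Gamma> n"
    unfolding Sn_def by (rule bounded_opD(1)[OF contraction_opD(1)[OF contraction_op_Sn[OF associated]] p])
  have sum': "summable (\<lambda>i. (norm (tail ?q i))\<^sup>2)"
    unfolding tail_def by (rule summable_chain_pair[OF q_n[OF q]])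
  show "h - z *\<^sub>C T0 \<Gamma> h = p - z *\<^sub>C Sn \<Gamma> n T p"
  proof (rule hsum_eqI)
    fix j
    show "hnth (h - z *\<^sub>C T0 \<Gamma> h) j = hnth (p - z *\<^sub>C Sn \<Gamma> n T p) j"
      unfolding T0 hnth_diff hnth_scaleC nth hnth_splice_at[OF sum']
      using p Sn by (cases "j \<le> n") (simp_all add: KK_def)
  qed
  show "orth_proj (KK \<Gamma> n) h = p"
    unfolding h_def
    by (rule orth_proj_splice_at[OF sum closed_csubspace_sums(3) _ p]) (simp add: KK_def)
qed

text \<open>
  Here the factors act in the other order, so the continuation is the rotated tail rather than
  the tail.
\<close>

lemma resolvent_T0t:
  assumes q: "q \<in> KKt \<Gamma> n"
  shows "extend q - z *\<^sub>C T0t \<Gamma> (extend q) = q - z *\<^sub>C Snt \<Gamma> n T q"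
    "orth_proj (KKt \<Gamma> n) (extend q) = q"
proof -
  let ?p = "Wn \<Gamma> n T q"
  have p: "?p \<in> KK \<Gamma> n" by (rule bounded_opD(1)[OF contraction_opD(1)[OF contraction_op_Wn[OF associated]] q])
  have Snt: "Snt \<Gamma> n T q \<in> KKt \<Gamma> n"
    unfolding Snt_def by (rule bounded_opD(1)[OF contraction_opD(1)[OF contraction_op_Snt[OF associated]] q])
  have sum: "summable (\<lambda>i. (norm (tail q i))\<^sup>2)"
    unfolding tail_def by (rule summable_chain_pair[OF q_n[OF q]])
  have W: "W0 \<Gamma> (extend q) \<in> HH \<Gamma>"
    by (rule bounded_opD(1)[OF contraction_opD(1)[OF contraction_op_W0] extend_in[OF q]])
  have "z *\<^sub>C hnth (T0t \<Gamma> (extend q)) j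
      = (if j \<le> n then z *\<^sub>C hnth (Snt \<Gamma> n T q) j else tail_image q (j - Suc n))" for j
  proof (cases "j \<le> n")
    case True
    then show ?thesis
      using hnth_V0[OF W, of j] hnth_V0[OF KK_subset[OF p], of j, folded Vn_eq_V0[OF p]]
      by (simp add: T0t_def Snt_def W0_extend[OF q] hnth_splice_at[OF sum])
  next
    case False
    then obtain i where j: "j = Suc (n + i)" using less_imp_Suc_add not_le by blast
    have "tail q i \<in> src \<Gamma> (2*j + 1) \<times> tgt \<Gamma> (Suc (2*j + 1))"
      using chain_pair_in[OF q_n[OF q], of i] by (simp add: tail_def j)
    from rot_props(2)[OF this, of z] show ?thesis
      using hnth_V0[OF W, of j] False
      by (simp add: T0t_def W0_extend[OF q] hnth_splice_at[OF sum]) (simp add: j tail_image_def)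
  qed
  then show "extend q - z *\<^sub>C T0t \<Gamma> (extend q) = q - z *\<^sub>C Snt \<Gamma> n T q"
    using q Snt by (intro hsum_eqI) (simp add: hnth_extend[OF q] KKt_def)
  show "orth_proj (KKt \<Gamma> n) (extend q) = q"
    by (rule orth_proj_splice_at[OF summable_tail_image[OF q] closed_csubspace_sums(4) _ q])
       (simp add: KKt_def)
qed

lemma compressed_resolvents:
  "invertible_op (HH \<Gamma>) (\<lambda>f. f - z *\<^sub>C T0 \<Gamma> f) \<and>
   invertible_op (KK \<Gamma> n) (\<lambda>f. f - z *\<^sub>C Sn \<Gamma> n T f) \<and>
   (\<forall>f\<in>KK \<Gamma> n.
      orth_proj (KK \<Gamma> n) (inv_into (HH \<Gamma>) (\<lambda>h. h - z *\<^sub>C T0 \<Gamma> h) f) =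
      inv_into (KK \<Gamma> n) (\<lambda>h. h - z *\<^sub>C Sn \<Gamma> n T h) f) \<and>
   invertible_op (HHt \<Gamma>) (\<lambda>g. g - z *\<^sub>C T0t \<Gamma> g) \<and>
   invertible_op (KKt \<Gamma> n) (\<lambda>g. g - z *\<^sub>C Snt \<Gamma> n T g) \<and>
   (\<forall>g\<in>KKt \<Gamma> n.
      orth_proj (KKt \<Gamma> n) (inv_into (HHt \<Gamma>) (\<lambda>h. h - z *\<^sub>C T0t \<Gamma> h) g) =
      inv_into (KKt \<Gamma> n) (\<lambda>h. h - z *\<^sub>C Snt \<Gamma> n T h) g)"
proof (intro conjI ballI)
  note inv = invertible_op_id_minus[OF closed_csubspace_sums(1) contraction_op_T0 z, folded T0_def]
    invertible_op_id_minus[OF closed_csubspace_sums(3) contraction_op_Sn[OF associated] z, folded Sn_def]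
    invertible_op_id_minus[OF closed_csubspace_sums(2) contraction_op_T0t z, folded T0t_def]
    invertible_op_id_minus[OF closed_csubspace_sums(4) contraction_op_Snt[OF associated] z, folded Snt_def]
  show "invertible_op (HH \<Gamma>) (\<lambda>f. f - z *\<^sub>C T0 \<Gamma> f)"
    "invertible_op (KK \<Gamma> n) (\<lambda>f. f - z *\<^sub>C Sn \<Gamma> n T f)"
    "invertible_op (HHt \<Gamma>) (\<lambda>g. g - z *\<^sub>C T0t \<Gamma> g)"
    "invertible_op (KKt \<Gamma> n) (\<lambda>g. g - z *\<^sub>C Snt \<Gamma> n T g)"
    by (fact inv)+
  show "orth_proj (KK \<Gamma> n) (inv_into (HH \<Gamma>) (\<lambda>h. h - z *\<^sub>C T0 \<Gamma> h) f) =
      inv_into (KK \<Gamma> n) (\<lambda>h. h - z *\<^sub>C Sn \<Gamma> n T h) f" if f: "f \<in> KK \<Gamma> n" for f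
  proof -
    let ?p = "inv_into (KK \<Gamma> n) (\<lambda>h. h - z *\<^sub>C Sn \<Gamma> n T h) f"
    note p = invertible_op_inv_into(1,2)[OF inv(2) f]
    show ?thesis
      using invertible_op_inv_into(3)[OF inv(1) resolvent_T0(1)[OF p(1)]] resolvent_T0(3)[OF p(1)]
      unfolding resolvent_T0(2)[OF p(1)] p(2) by simp
  qed
  show "orth_proj (KKt \<Gamma> n) (inv_into (HHt \<Gamma>) (\<lambda>h. h - z *\<^sub>C T0t \<Gamma> h) g) =
      inv_into (KKt \<Gamma> n) (\<lambda>h. h - z *\<^sub>C Snt \<Gamma> n T h) g" if g: "g \<in> KKt \<Gamma> n" for g
  proof -
    let ?q = "inv_into (KKt \<Gamma> n) (\<lambda>h. h - z *\<^sub>C Snt \<Gamma> n T h) g"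
    note q = invertible_op_inv_into(1,2)[OF inv(4) g]
    show ?thesis
      using invertible_op_inv_into(3)[OF inv(3) extend_in[OF q(1)]] resolvent_T0t(2)[OF q(1)]
      unfolding resolvent_T0t(1)[OF q(1)] q(2) by simp
  qed
qed

end

end

text \<open>
  The parameters are contractions because they are values at \<open>0\<close> of the associated functions.
\<close>

lemma schur_algorithm_recursion:
  fixes \<Theta>s :: "nat \<Rightarrow> complex \<Rightarrow> 'm :: chilbert_space \<Rightarrow> 'n :: chilbert_space"
  assumes \<Theta>: "schur_class UNIV UNIV \<Theta>" and alg: "schur_algorithm \<Theta> \<Theta>s \<Gamma>" and z: "z \<in> ball 0 1"
  shows "schur_recursion \<Gamma> z (\<lambda>k. \<Theta>s k z)"
proof -
  have contr: "contraction_op (src \<Gamma> k) (tgt \<Gamma> k) (\<Theta>s k w)" if "w \<in> ball 0 1" for k w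
  proof -
    have "schur_class (src \<Gamma> k) (tgt \<Gamma> k) (\<Theta>s k)"
    proof (cases k)
      case 0
      then show ?thesis using \<Theta> alg by (simp add: schur_algorithm_def src_def tgt_def)
    next
      case (Suc m)
      then show ?thesis using alg unfolding schur_algorithm_def by blast
    qed
    then show ?thesis
      using that by (intro contraction_op_of_onorm_on) (simp_all add: schur_class_def)
  qed
  show ?thesis
  proof
    fix k x
    show "contraction_op (src \<Gamma> k) (tgt \<Gamma> k) (\<Gamma> k)"
      using contr[of 0 k] alg by (simp add: schur_algorithm_def)
    show "cmod z < 1" using z by simp
    show "contraction_op (src \<Gamma> k) (tgt \<Gamma> k) (\<Theta>s k z)" by (rule contr[OF z])
    show "\<Theta>s k z x = \<Gamma> k x + z *\<^sub>C D\<Gamma>adj \<Gamma> k (\<Theta>s (Suc k) z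
          (inv_into (src \<Gamma> (Suc k)) (\<lambda>u. u + z *\<^sub>C \<Gamma>adj \<Gamma> k (\<Theta>s (Suc k) z u)) (D\<Gamma> \<Gamma> k x)))"
      if "x \<in> src \<Gamma> k"
      using alg z that unfolding schur_algorithm_def by blast
  qed
qed

theorem theorem4p4:
  fixes \<Theta> :: "complex \<Rightarrow> 'm::{chilbert_space, second_countable_topology} \<Rightarrow>
                 'n::{chilbert_space, second_countable_topology}"
    and \<Theta>s :: "nat \<Rightarrow> complex \<Rightarrow> 'm \<Rightarrow> 'n"
    and \<Gamma> :: "nat \<Rightarrow> 'm \<Rightarrow> 'n"
    and n :: nat
  assumes "schur_class UNIV UNIV \<Theta>"
    and "schur_algorithm \<Theta> \<Theta>s \<Gamma>"
    and "defect_space (src \<Gamma> (2*n + 1)) (\<Gamma> (2*n + 1)) \<noteq> {0}"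
    and "defect_space (tgt \<Gamma> (2*n + 1)) (\<Gamma>adj \<Gamma> (2*n + 1)) \<noteq> {0}"
  shows "\<forall>z\<in>ball 0 1.
     invertible_op (HH \<Gamma>) (\<lambda>f. f - z *\<^sub>C T0 \<Gamma> f) \<and>
     invertible_op (KK \<Gamma> n) (\<lambda>f. f - z *\<^sub>C Sn \<Gamma> n (\<Theta>s (2*n + 2) z) f) \<and>
     (\<forall>f\<in>KK \<Gamma> n.
        orth_proj (KK \<Gamma> n) (inv_into (HH \<Gamma>) (\<lambda>h. h - z *\<^sub>C T0 \<Gamma> h) f) =
        inv_into (KK \<Gamma> n) (\<lambda>h. h - z *\<^sub>C Sn \<Gamma> n (\<Theta>s (2*n + 2) z) h) f) \<and>
     invertible_op (HHt \<Gamma>) (\<lambda>g. g - z *\<^sub>C T0t \<Gamma> g) \<and>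
     invertible_op (KKt \<Gamma> n) (\<lambda>g. g - z *\<^sub>C Snt \<Gamma> n (\<Theta>s (2*n + 2) z) g) \<and>
     (\<forall>g\<in>KKt \<Gamma> n.
        orth_proj (KKt \<Gamma> n) (inv_into (HHt \<Gamma>) (\<lambda>h. h - z *\<^sub>C T0t \<Gamma> h) g) =
        inv_into (KKt \<Gamma> n) (\<lambda>h. h - z *\<^sub>C Snt \<Gamma> n (\<Theta>s (2*n + 2) z) h) g)"
proof
  fix z :: complex assume "z \<in> ball 0 1"
  then interpret schur_recursion \<Gamma> z "\<lambda>k. \<Theta>s k z"
    by (rule schur_algorithm_recursion[OF assms(1,2)])
  show "invertible_op (HH \<Gamma>) (\<lambda>f. f - z *\<^sub>C T0 \<Gamma> f) \<and>
     invertible_op (KK \<Gamma> n) (\<lambda>f. f - z *\<^sub>C Sn \<Gamma> n (\<Theta>s (2*n + 2) z) f) \<and>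
     (\<forall>f\<in>KK \<Gamma> n.
        orth_proj (KK \<Gamma> n) (inv_into (HH \<Gamma>) (\<lambda>h. h - z *\<^sub>C T0 \<Gamma> h) f) =
        inv_into (KK \<Gamma> n) (\<lambda>h. h - z *\<^sub>C Sn \<Gamma> n (\<Theta>s (2*n + 2) z) h) f) \<and>
     invertible_op (HHt \<Gamma>) (\<lambda>g. g - z *\<^sub>C T0t \<Gamma> g) \<and>
     invertible_op (KKt \<Gamma> n) (\<lambda>g. g - z *\<^sub>C Snt \<Gamma> n (\<Theta>s (2*n + 2) z) g) \<and>
     (\<forall>g\<in>KKt \<Gamma> n.
        orth_proj (KKt \<Gamma> n) (inv_into (HHt \<Gamma>) (\<lambda>h. h - z *\<^sub>C T0t \<Gamma> h) g) =
        inv_into (KKt \<Gamma> n) (\<lambda>h. h - z *\<^sub>C Snt \<Gamma> n (\<Theta>s (2*n + 2) z) h) g)"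
    by (rule compressed_resolvents)
qed

end
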